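(* Let $C/\mathbb{Q}$ be an elliptic curve with $j(C)\notin\{0,1728\}$ and let $p\ge5$ be a prime of good reduction for $C$ with $v_p(j(C))=0=v_p(j(C)-1728)$. Let $a_p(C)=p+1-|C(\mathbb{F}_p)|$. Write $\frac{E_4}{j-j(C)}=\sum_{n\ge1}a_n\big(\frac{E_4}{j-j(C)}\big)q^n$. Then \[ a_p\Big(\frac{E_4}{j-j(C)}\Big)\equiv a_p(C)^2\pmod p. \]
   Context: $q=e^{2\pi i z}$; $E_4=1+240\sum_{n\ge1}\sigma_3(n)q^n$ is the normalized weight-$4$ Eisenstein series and $j=q^{-1}+744+\cdots$ the modular $j$-invariant. The $q$-expansion of $E_4/(j-c)$ is the expansion at $\infty$ (equivalently the formal expansion $\sum_{m\ge0}c^mE_4 j^{-m-1}$ in powers of $q$, using $j^{-1}=q+O(q^2)$); its coefficients are polynomials in $c$ with integer coefficients, hence are $p$-integral rationals here. *)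

theory Defs
  imports "HOL-Computational_Algebra.Computational_Algebra"
begin

definition sigma_sum :: "nat \<Rightarrow> nat \<Rightarrow> nat" where
  "sigma_sum k n = (\<Sum>d | d dvd n. d ^ k)"

definition E4 :: "rat fps" where
  "E4 = Abs_fps (\<lambda>n. if n = 0 then 1 else 240 * of_nat (sigma_sum 3 n))"

definition E6 :: "rat fps" where
  "E6 = Abs_fps (\<lambda>n. if n = 0 then 1 else - 504 * of_nat (sigma_sum 5 n))"

text \<open>The \<open>q\<close>-expansion \<open>q\<^sup>-\<^sup>1 + 744 + 196884 q + \<dots>\<close> of the modular invariant, as
  \<open>E4\<^sup>3 / \<Delta>\<close> with \<open>\<Delta> = (E4\<^sup>3 - E6\<^sup>2) / 1728\<close>.\<close>

definition modular_j :: "rat fls" where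
  "modular_j = 1728 * fps_to_fls (E4 ^ 3) / fps_to_fls (E4 ^ 3 - E6 ^ 2)"

text \<open>The quotient is taken in the field of formal Laurent series, where \<open>j - c\<close> has leading
  term \<open>q\<^sup>-\<^sup>1\<close>.\<close>

definition E4_div_j_minus :: "rat \<Rightarrow> rat fls" where
  "E4_div_j_minus c = fps_to_fls E4 / (modular_j - fls_const c)"


text \<open>The valuation of a nonzero rational; the value at \<open>0\<close> is the junk value \<open>0\<close>.\<close>

definition padic_val :: "nat \<Rightarrow> rat \<Rightarrow> int" where
  "padic_val p x = (case quotient_of x of (a, b) \<Rightarrow>
     int (multiplicity (int p) a) - int (multiplicity (int p) b))"

definition p_integral :: "nat \<Rightarrow> rat \<Rightarrow> bool" where
  "p_integral p x \<longleftrightarrow> \<not> int p dvd snd (quotient_of x)"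

text \<open>Congruence modulo \<open>p\<close> in the local ring of \<open>p\<close>-integral rationals.\<close>

definition rat_cong :: "nat \<Rightarrow> rat \<Rightarrow> rat \<Rightarrow> bool" where
  "rat_cong p x y \<longleftrightarrow> p_integral p x \<and> p_integral p y \<and> (\<exists>z. p_integral p z \<and> x - y = of_nat p * z)"


text \<open>The Weierstrass equation \<open>y\<^sup>2 + a1 x y + a3 y = x\<^sup>3 + a2 x\<^sup>2 + a4 x + a6\<close>.\<close>

record weierstrass =
  a1 :: rat
  a2 :: rat
  a3 :: rat
  a4 :: rat
  a6 :: rat

definition b2 :: "weierstrass \<Rightarrow> rat" where
  "b2 W = (a1 W)\<^sup>2 + 4 * a2 W"

definition b4 :: "weierstrass \<Rightarrow> rat" where
  "b4 W = 2 * a4 W + a1 W * a3 W"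

definition b6 :: "weierstrass \<Rightarrow> rat" where
  "b6 W = (a3 W)\<^sup>2 + 4 * a6 W"

definition b8 :: "weierstrass \<Rightarrow> rat" where
  "b8 W = (a1 W)\<^sup>2 * a6 W + 4 * a2 W * a6 W - a1 W * a3 W * a4 W + a2 W * (a3 W)\<^sup>2 - (a4 W)\<^sup>2"

definition c4 :: "weierstrass \<Rightarrow> rat" where
  "c4 W = (b2 W)\<^sup>2 - 24 * b4 W"

definition discriminant :: "weierstrass \<Rightarrow> rat" where
  "discriminant W = - (b2 W)\<^sup>2 * b8 W - 8 * (b4 W) ^ 3 - 27 * (b6 W)\<^sup>2 + 9 * b2 W * b4 W * b6 W"

definition elliptic_curve :: "weierstrass \<Rightarrow> bool" where
  "elliptic_curve W \<longleftrightarrow> discriminant W \<noteq> 0"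

definition j_invariant :: "weierstrass \<Rightarrow> rat" where
  "j_invariant W = (c4 W) ^ 3 / discriminant W"

text \<open>\<open>W'\<close> arises from \<open>W\<close> by the substitution
  \<open>x = u\<^sup>2 x' + r\<close>, \<open>y = u\<^sup>3 y' + s u\<^sup>2 x' + t\<close>.\<close>

definition change_of_vars ::
    "rat \<Rightarrow> rat \<Rightarrow> rat \<Rightarrow> rat \<Rightarrow> weierstrass \<Rightarrow> weierstrass \<Rightarrow> bool" where
  "change_of_vars u r s t W W' \<longleftrightarrow> u \<noteq> 0 \<and>
     u * a1 W' = a1 W + 2 * s \<and>
     u ^ 2 * a2 W' = a2 W - s * a1 W + 3 * r - s\<^sup>2 \<and>
     u ^ 3 * a3 W' = a3 W + r * a1 W + 2 * t \<and>
     u ^ 4 * a4 W' = a4 W - s * a3 W + 2 * r * a2 W - (t + r * s) * a1 W + 3 * r\<^sup>2 - 2 * s * t \<and>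
     u ^ 6 * a6 W' = a6 W + r * a4 W + r\<^sup>2 * a2 W + r ^ 3 - t * a3 W - t\<^sup>2 - r * t * a1 W"

definition isomorphic_over_Q :: "weierstrass \<Rightarrow> weierstrass \<Rightarrow> bool" where
  "isomorphic_over_Q W W' \<longleftrightarrow> (\<exists>u r s t. change_of_vars u r s t W W')"

definition good_model :: "nat \<Rightarrow> weierstrass \<Rightarrow> weierstrass \<Rightarrow> bool" where
  "good_model p W M \<longleftrightarrow> isomorphic_over_Q W M \<and>
     p_integral p (a1 M) \<and> p_integral p (a2 M) \<and> p_integral p (a3 M) \<and>
     p_integral p (a4 M) \<and> p_integral p (a6 M) \<and>
     discriminant M \<noteq> 0 \<and> padic_val p (discriminant M) = 0"

definition good_reduction :: "nat \<Rightarrow> weierstrass \<Rightarrow> bool" where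
  "good_reduction p W \<longleftrightarrow> (\<exists>M. good_model p W M)"

text \<open>The points over the field with \<open>p\<close> elements of the reduction modulo \<open>p\<close> of a
  \<open>p\<close>-integral model: \<open>None\<close> is the point at infinity, and the elements of the field are
  represented by \<open>0, \<dots>, p - 1\<close>.\<close>

definition reduction_points :: "nat \<Rightarrow> weierstrass \<Rightarrow> (int \<times> int) option set" where
  "reduction_points p M = insert None (Some ` {(x, y). x \<in> {0..<int p} \<and> y \<in> {0..<int p} \<and>
     rat_cong p ((of_int y)\<^sup>2 + a1 M * of_int x * of_int y + a3 M * of_int y)
                ((of_int x) ^ 3 + a2 M * (of_int x)\<^sup>2 + a4 M * of_int x + a6 M)})"

text \<open>The choice of the model is immaterial; see \<open>frob_trace_eq\<close> below.\<close>

definition frob_trace :: "nat \<Rightarrow> weierstrass \<Rightarrow> int" where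
  "frob_trace p W = int p + 1 - int (card (reduction_points p (SOME M. good_model p W M)))"

lemma p_integral_iff:
  assumes "prime p"
  shows "p_integral p x \<longleftrightarrow> (\<exists>a b. \<not> int p dvd b \<and> x = of_int a / of_int b)"
proof
  assume "p_integral p x"
  then show "\<exists>a b. \<not> int p dvd b \<and> x = of_int a / of_int b"
    unfolding p_integral_def by (metis prod.collapse quotient_of_div)
next
  assume "\<exists>a b. \<not> int p dvd b \<and> x = of_int a / of_int b"
  then obtain a b where ab: "\<not> int p dvd b" "x = of_int a / of_int b" by blast
  obtain c d where cd: "quotient_of x = (c, d)" by fastforce
  have d: "d > 0" "coprime c d" "x = of_int c / of_int d"
    using cd quotient_of_denom_pos quotient_of_coprime quotient_of_div by blast+
  have "b \<noteq> 0" using ab by auto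
  then have "(of_int (a * d) :: rat) = of_int (c * b)"
    using d ab by (simp add: field_simps)
  then have "a * d = c * b" using of_int_eq_iff by blast
  then have "d dvd b" using d(2)
    by (metis coprime_commute coprime_dvd_mult_right_iff dvd_triv_right)
  then show "p_integral p x" unfolding p_integral_def cd using ab(1) dvd_trans by auto
qed

lemma p_integral_of_int: "prime p \<Longrightarrow> p_integral p (of_int n)"
  using p_integral_iff[of p "of_int n"] not_prime_unit
  by (metis div_by_1 of_int_1 of_nat_dvd_iff of_nat_1 prime_nat_iff nat_dvd_1_iff_1)

lemma p_integral_mult:
  assumes "prime p" "p_integral p x" "p_integral p y"
  shows "p_integral p (x * y)"
proof -
  obtain a b c d where "\<not> int p dvd b" "x = of_int a / of_int b"
    "\<not> int p dvd d" "y = of_int c / of_int d"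
    using assms p_integral_iff by metis
  then have "\<not> int p dvd b * d \<and> x * y = of_int (a * c) / of_int (b * d)"
    using assms(1) by (simp add: prime_dvd_mult_iff)
  then show ?thesis using p_integral_iff[OF assms(1)] by blast
qed

lemma p_integral_add:
  assumes "prime p" "p_integral p x" "p_integral p y"
  shows "p_integral p (x + y)"
proof -
  obtain a b c d where *: "\<not> int p dvd b" "x = of_int a / of_int b"
    "\<not> int p dvd d" "y = of_int c / of_int d"
    using assms p_integral_iff by metis
  then have "b \<noteq> 0" "d \<noteq> 0" by auto
  then have "\<not> int p dvd b * d \<and> x + y = of_int (a * d + c * b) / of_int (b * d)"
    using assms(1) * by (simp add: prime_dvd_mult_iff field_simps)
  then show ?thesis using p_integral_iff[OF assms(1)] by blast
qed

lemma p_integral_numeral: "prime p \<Longrightarrow> p_integral p (numeral n)"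
  using p_integral_of_int[of p "numeral n"] by simp

lemma p_integral_uminus: "prime p \<Longrightarrow> p_integral p x \<Longrightarrow> p_integral p (- x)"
  using p_integral_mult[of p "of_int (-1)" x] p_integral_of_int[of p "-1"] by simp

lemma p_integral_diff: "prime p \<Longrightarrow> p_integral p x \<Longrightarrow> p_integral p y \<Longrightarrow> p_integral p (x - y)"
  using p_integral_add[of p x "- y"] p_integral_uminus by simp

lemma p_integral_power: "prime p \<Longrightarrow> p_integral p x \<Longrightarrow> p_integral p (x ^ n)"
  by (induction n) (use p_integral_of_int[of p 1] p_integral_mult in auto)

lemmas p_integral_rules = p_integral_of_int p_integral_numeral p_integral_mult p_integral_add
  p_integral_uminus p_integral_diff p_integral_power

lemma p_integral_divide_unit:
  assumes "prime p" "\<not> int p dvd n" "p_integral p (of_int n * x)"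
  shows "p_integral p x"
proof -
  have "n \<noteq> 0" using assms by auto
  have "p_integral p (1 / of_int n)" using p_integral_iff[OF assms(1)] assms(2) by (metis of_int_1)
  then have "p_integral p (1 / of_int n * (of_int n * x))" using assms p_integral_mult by blast
  then show ?thesis using \<open>n \<noteq> 0\<close> by simp
qed

lemma p_integral_root:
  assumes "prime p" "p_integral p (x ^ n)" "n > 0"
  shows "p_integral p x"
proof -
  obtain c d where cd: "quotient_of x = (c, d)" by fastforce
  have d: "d > 0" "coprime c d" "x = of_int c / of_int d"
    using cd quotient_of_denom_pos quotient_of_coprime quotient_of_div by blast+
  obtain a b where ab: "\<not> int p dvd b" "x ^ n = of_int a / of_int b"
    using p_integral_iff assms by blast
  have "b \<noteq> 0" using ab by auto
  have "x ^ n = of_int (c ^ n) / of_int (d ^ n)" using d by (simp add: power_divide)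
  then have "of_int a / of_int b = (of_int (c ^ n) / of_int (d ^ n) :: rat)" using ab by simp
  then have "(of_int (a * d ^ n) :: rat) = of_int (c ^ n * b)"
    using d(1) \<open>b \<noteq> 0\<close> by (simp add: frac_eq_eq)
  then have eq: "a * d ^ n = c ^ n * b" using of_int_eq_iff by blast
  have "\<not> int p dvd d"
  proof
    assume pd: "int p dvd d"
    then have "int p dvd c ^ n * b" using eq assms(3)
      by (metis dvd_mult dvd_power dvd_trans)
    then have "int p dvd c" using ab(1) assms(1)
      by (meson prime_dvd_mult_iff prime_dvd_power prime_nat_int_transfer)
    then show False using pd d(2) assms(1)
      by (meson coprime_common_divisor not_prime_unit prime_nat_int_transfer)
  qed
  then show ?thesis unfolding p_integral_def cd by simp
qed

lemma padic_val_0_integral: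
  assumes "prime p" "x \<noteq> 0" "padic_val p x = 0"
  shows "p_integral p x" "p_integral p (1 / x)"
proof -
  obtain c d where cd: "quotient_of x = (c, d)" by fastforce
  have d: "d > 0" "coprime c d" "x = of_int c / of_int d"
    using cd quotient_of_denom_pos quotient_of_coprime quotient_of_div by blast+
  have c: "c \<noteq> 0" using d assms by auto
  have nu: "\<not> is_unit (int p)" using assms(1) by (simp add: prime_nat_iff)
  have m: "multiplicity (int p) c = multiplicity (int p) d"
    using assms(3) cd unfolding padic_val_def by simp
  have "int p dvd c \<longleftrightarrow> int p dvd d"
    using m c d(1) nu by (metis multiplicity_eq_zero_iff less_irrefl)
  then have n: "\<not> int p dvd d" "\<not> int p dvd c"
    using d(2) nu by (meson coprime_common_divisor)+
  show "p_integral p x" using p_integral_iff[OF assms(1)] n d by blast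
  have "1 / x = of_int d / of_int c" using d by simp
  then show "p_integral p (1 / x)" using p_integral_iff[OF assms(1)] n by blast
qed

lemma change_of_vars_compose:
  assumes "change_of_vars u1 r1 s1 t1 W M1" "change_of_vars u2 r2 s2 t2 W M2"
  shows "change_of_vars (u2 / u1) ((r2 - r1) / u1 ^ 2) ((s2 - s1) / u1)
           ((t2 - t1 - s1 * (r2 - r1)) / u1 ^ 3) M1 M2"
proof -
  have u: "u1 \<noteq> 0" "u2 \<noteq> 0" using assms unfolding change_of_vars_def by auto
  have A: "a1 M1 = (a1 W + 2 * s1) / u1"
    "a2 M1 = (a2 W - s1 * a1 W + 3 * r1 - s1\<^sup>2) / u1 ^ 2"
    "a3 M1 = (a3 W + r1 * a1 W + 2 * t1) / u1 ^ 3"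
    "a4 M1 = (a4 W - s1 * a3 W + 2 * r1 * a2 W - (t1 + r1 * s1) * a1 W + 3 * r1\<^sup>2 - 2 * s1 * t1) / u1 ^ 4"
    "a6 M1 = (a6 W + r1 * a4 W + r1\<^sup>2 * a2 W + r1 ^ 3 - t1 * a3 W - t1\<^sup>2 - r1 * t1 * a1 W) / u1 ^ 6"
    using assms(1) u unfolding change_of_vars_def by (simp_all add: nonzero_eq_divide_eq mult.commute)
  have B: "a1 M2 = (a1 W + 2 * s2) / u2"
    "a2 M2 = (a2 W - s2 * a1 W + 3 * r2 - s2\<^sup>2) / u2 ^ 2"
    "a3 M2 = (a3 W + r2 * a1 W + 2 * t2) / u2 ^ 3"
    "a4 M2 = (a4 W - s2 * a3 W + 2 * r2 * a2 W - (t2 + r2 * s2) * a1 W + 3 * r2\<^sup>2 - 2 * s2 * t2) / u2 ^ 4"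
    "a6 M2 = (a6 W + r2 * a4 W + r2\<^sup>2 * a2 W + r2 ^ 3 - t2 * a3 W - t2\<^sup>2 - r2 * t2 * a1 W) / u2 ^ 6"
    using assms(2) u unfolding change_of_vars_def by (simp_all add: nonzero_eq_divide_eq mult.commute)
  show ?thesis unfolding change_of_vars_def A B using u
    apply (intro conjI)
    subgoal by simp
    subgoal by (simp add: field_simps)
    subgoal by (simp add: divide_simps) algebra
    subgoal by (simp add: divide_simps) algebra
    subgoal by (simp add: divide_simps) algebra
    subgoal by (simp add: divide_simps) algebra
    done
qed

lemma discriminant_change_of_vars:
  assumes "change_of_vars u r s t W M"
  shows "u ^ 12 * discriminant M = discriminant W"
proof -
  have e: "u * a1 M = a1 W + 2 * s"
     "u ^ 2 * a2 M = a2 W - s * a1 W + 3 * r - s\<^sup>2"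
     "u ^ 3 * a3 M = a3 W + r * a1 W + 2 * t"
     "u ^ 4 * a4 M = a4 W - s * a3 W + 2 * r * a2 W - (t + r * s) * a1 W + 3 * r\<^sup>2 - 2 * s * t"
     "u ^ 6 * a6 M = a6 W + r * a4 W + r\<^sup>2 * a2 W + r ^ 3 - t * a3 W - t\<^sup>2 - r * t * a1 W"
    using assms unfolding change_of_vars_def by auto
  have "u ^ 2 * b2 M = (u * a1 M)\<^sup>2 + 4 * (u ^ 2 * a2 M)" unfolding b2_def by algebra
  then have b2: "u ^ 2 * b2 M = b2 W + 12 * r" unfolding e unfolding b2_def by algebra
  have "u ^ 4 * b4 M = 2 * (u ^ 4 * a4 M) + (u * a1 M) * (u ^ 3 * a3 M)" unfolding b4_def by algebra
  then have b4: "u ^ 4 * b4 M = b4 W + r * b2 W + 6 * r ^ 2" unfolding e unfolding b2_def b4_def by algebra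
  have "u ^ 6 * b6 M = (u ^ 3 * a3 M)\<^sup>2 + 4 * (u ^ 6 * a6 M)" unfolding b6_def by algebra
  then have b6: "u ^ 6 * b6 M = b6 W + 2 * r * b4 W + r ^ 2 * b2 W + 4 * r ^ 3"
    unfolding e unfolding b2_def b4_def b6_def by algebra
  have "4 * b8 M = b2 M * b6 M - b4 M ^ 2" "4 * b8 W = b2 W * b6 W - b4 W ^ 2"
    unfolding b2_def b4_def b6_def b8_def by algebra+
  then have b8: "b8 M = (b2 M * b6 M - b4 M ^ 2) / 4" "b8 W = (b2 W * b6 W - b4 W ^ 2) / 4" by simp_all
  have "4 * discriminant M = - (b2 M)\<^sup>2 * (b2 M * b6 M - b4 M ^ 2) - 32 * b4 M ^ 3 - 108 * b6 M ^ 2 + 36 * b2 M * b4 M * b6 M"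
    unfolding discriminant_def b8 by simp
  then have "4 * (u ^ 12 * discriminant M) = - (u ^ 2 * b2 M)\<^sup>2 * ((u ^ 2 * b2 M) * (u ^ 6 * b6 M) - (u ^ 4 * b4 M) ^ 2)
     - 32 * (u ^ 4 * b4 M) ^ 3 - 108 * (u ^ 6 * b6 M) ^ 2 + 36 * (u ^ 2 * b2 M) * (u ^ 4 * b4 M) * (u ^ 6 * b6 M)"
    by algebra
  also have "\<dots> = - (b2 W)\<^sup>2 * (b2 W * b6 W - b4 W ^ 2) - 32 * b4 W ^ 3 - 108 * b6 W ^ 2 + 36 * b2 W * b4 W * b6 W"
    unfolding b2 b4 b6 by algebra
  also have "\<dots> = 4 * discriminant W" unfolding discriminant_def b8 by simp
  finally show ?thesis by simp
qed

definition res_mod :: "nat \<Rightarrow> rat \<Rightarrow> int" where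
  "res_mod p x = (SOME n. n \<in> {0..<int p} \<and> rat_cong p (of_int n) x)"

lemma rat_cong_iff:
  assumes "prime p" "p_integral p x" "p_integral p y"
  shows "rat_cong p x y \<longleftrightarrow> p_integral p ((x - y) / of_nat p)"
proof -
  have "p > 0" using assms(1) prime_gt_0_nat by blast
  then show ?thesis using assms unfolding rat_cong_def
    by (auto simp: field_simps)
qed

lemma rat_cong_of_int:
  assumes "prime p" "rat_cong p (of_int m) (of_int n)"
  shows "int p dvd m - n"
proof -
  obtain z where z: "p_integral p z" "of_int m - of_int n = of_nat p * z"
    using assms(2) unfolding rat_cong_def by blast
  obtain a b where ab: "\<not> int p dvd b" "z = of_int a / of_int b"
    using z p_integral_iff[OF assms(1)] by blast
  have "b \<noteq> 0" using ab by auto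
  then have "(of_int ((m - n) * b) :: rat) = of_int (int p * a)"
    using z ab by (simp add: field_simps)
  then have "(m - n) * b = int p * a" using of_int_eq_iff by blast
  then show ?thesis using ab assms(1)
    by (metis dvd_triv_left prime_dvd_mult_iff prime_nat_int_transfer)
qed

lemma res_mod:
  assumes "prime p" "p_integral p x"
  shows "res_mod p x \<in> {0..<int p} \<and> rat_cong p (of_int (res_mod p x)) x"
proof -
  obtain a b where ab: "\<not> int p dvd b" "x = of_int a / of_int b"
    using assms p_integral_iff by blast
  have b0: "b \<noteq> 0" using ab by auto
  have p0: "p > 0" using assms(1) prime_gt_0_nat by blast
  have "coprime b (int p)" using ab(1) assms(1)
    by (meson coprime_commute prime_imp_coprime prime_nat_int_transfer)
  then obtain u v where uv: "b * u + int p * v = 1"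
    by (metis bezout_int coprime_imp_gcd_eq_1 mult.commute)
  define n where "n = (a * u) mod int p"
  obtain k where k: "a * u = n + int p * k" unfolding n_def by (metis mod_mult_div_eq)
  have "n * b - a = int p * (- k * b - a * v)"
    using uv k by algebra
  then have "(of_int (n * b - a) :: rat) = of_int (int p * (- k * b - a * v))" by presburger
  then have "of_int n - x = of_nat p * (of_int (- k * b - a * v) / of_int b)"
    using ab b0 by (simp add: field_simps)
  moreover have "p_integral p (of_int (- k * b - a * v) / of_int b)"
    using p_integral_iff[OF assms(1)] ab(1) by blast
  ultimately have "rat_cong p (of_int n) x"
    unfolding rat_cong_def using assms p_integral_of_int by blast
  moreover have "n \<in> {0..<int p}" unfolding n_def using p0 by simp
  ultimately show ?thesis unfolding res_mod_def by (metis (mono_tags, lifting) someI)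
qed

lemma good_model_card_le:
  assumes p: "prime p" "p \<ge> 5" and M: "good_model p W M" and M': "good_model p W M'"
  shows "card (reduction_points p M') \<le> card (reduction_points p M)"
proof -
  note I = p_integral_rules[OF p(1)]
  have p0: "p > 0" using p by simp
  from M M' obtain u r s t where c: "change_of_vars u r s t M M'"
    unfolding good_model_def isomorphic_over_Q_def by (metis change_of_vars_compose)
  have iM: "p_integral p (a1 M)" "p_integral p (a2 M)" "p_integral p (a3 M)" "p_integral p (a4 M)" "p_integral p (a6 M)"
    using M unfolding good_model_def by auto
  have iM': "p_integral p (a1 M')" "p_integral p (a2 M')" "p_integral p (a3 M')" "p_integral p (a4 M')" "p_integral p (a6 M')"
    using M' unfolding good_model_def by auto
  have e: "u * a1 M' = a1 M + 2 * s"
     "u ^ 2 * a2 M' = a2 M - s * a1 M + 3 * r - s\<^sup>2"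
     "u ^ 3 * a3 M' = a3 M + r * a1 M + 2 * t"
     "u ^ 4 * a4 M' = a4 M - s * a3 M + 2 * r * a2 M - (t + r * s) * a1 M + 3 * r\<^sup>2 - 2 * s * t"
     "u ^ 6 * a6 M' = a6 M + r * a4 M + r\<^sup>2 * a2 M + r ^ 3 - t * a3 M - t\<^sup>2 - r * t * a1 M"
    and u0: "u \<noteq> 0"
    using c unfolding change_of_vars_def by auto
  have d: "discriminant M \<noteq> 0" "padic_val p (discriminant M) = 0"
    "discriminant M' \<noteq> 0" "padic_val p (discriminant M') = 0"
    using M M' unfolding good_model_def by auto
  have D: "u ^ 12 * discriminant M' = discriminant M" using discriminant_change_of_vars[OF c] .
  have "u ^ 12 = discriminant M * (1 / discriminant M')" using D d by (simp add: field_simps)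
  then have "p_integral p (u ^ 12)"
    using padic_val_0_integral(1)[OF p(1) d(1,2)] padic_val_0_integral(2)[OF p(1) d(3,4)] I(3) by metis
  then have u: "p_integral p u" using p_integral_root[OF p(1)] by simp
  have "(1 / u) ^ 12 = discriminant M' * (1 / discriminant M)" using D d u0 by (simp add: field_simps)
  then have "p_integral p ((1 / u) ^ 12)"
    using padic_val_0_integral(1)[OF p(1) d(3,4)] padic_val_0_integral(2)[OF p(1) d(1,2)] I(3) by metis
  then have u': "p_integral p (1 / u)" using p_integral_root[OF p(1), of "1 / u" 12] by simp
  have small: "\<not> int p dvd 2" "\<not> int p dvd 3"
    using p(2) by (auto dest!: zdvd_imp_le)
  have n12: "\<not> int p dvd 12"
  proof
    assume "int p dvd 12"
    then have "int p dvd 2 * (2 * 3)" by simp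
    then show False using small p(1) by (metis prime_dvd_mult_iff prime_nat_int_transfer)
  qed
  have "of_int 12 * r = u ^ 2 * (a1 M' ^ 2 + 4 * a2 M') - (a1 M ^ 2 + 4 * a2 M)"
    using e(1,2) by simp algebra
  moreover have "p_integral p \<dots>" by (intro I u iM iM')
  ultimately have r: "p_integral p r" using p_integral_divide_unit[OF p(1) n12] by metis
  have "of_int 2 * s = u * a1 M' - a1 M" using e(1) by simp
  moreover have "p_integral p \<dots>" by (intro I u iM iM')
  ultimately have s: "p_integral p s" using p_integral_divide_unit[OF p(1) small(1)] by metis
  have "of_int 2 * t = u ^ 3 * a3 M' - a3 M - r * a1 M" using e(3) by simp
  moreover have "p_integral p \<dots>" by (intro I u iM iM' r)
  ultimately have t: "p_integral p t" using p_integral_divide_unit[OF p(1) small(1)] by metis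
  define X where "X = (\<lambda>x::int. u ^ 2 * of_int x + r)"
  define Y where "Y = (\<lambda>(x::int) (y::int). u ^ 3 * of_int y + s * u ^ 2 * of_int x + t)"
  have iX: "p_integral p (X x)" and iY: "p_integral p (Y x y)" for x y
    unfolding X_def Y_def by (intro I u r s t)+
  define A where "A = (\<lambda>M :: weierstrass. {(x, y). x \<in> {0..<int p} \<and> y \<in> {0..<int p} \<and>
     rat_cong p ((of_int y)\<^sup>2 + a1 M * of_int x * of_int y + a3 M * of_int y)
                ((of_int x) ^ 3 + a2 M * (of_int x)\<^sup>2 + a4 M * of_int x + a6 M)})"
  have fin: "finite (A M)" for M :: weierstrass
    by (rule finite_subset[of _ "{0..<int p} \<times> {0..<int p}"]) (auto simp: A_def)
  have card: "card (reduction_points p M) = Suc (card (A M))" for M :: weierstrass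
  proof -
    have "reduction_points p M = insert None (Some ` A M)" unfolding reduction_points_def A_def ..
    then show ?thesis using fin[of M] by (simp add: card_image)
  qed
  define f where "f = (\<lambda>(x, y). (res_mod p (X x), res_mod p (Y x y)))"
  have pp: "(of_nat p :: rat) \<noteq> 0" using p0 by simp
  have E: "p_integral p ((y^2 + a1 N * x * y + a3 N * y) - (x^3 + a2 N * x^2 + a4 N * x + a6 N))"
    if "p_integral p x" "p_integral p y" "N = M \<or> N = M'" for x y N
    using that iM iM' by (auto intro!: I)
  have mem: "(x, y) \<in> A N \<longleftrightarrow> x \<in> {0..<int p} \<and> y \<in> {0..<int p} \<and>
    p_integral p ((((of_int y)\<^sup>2 + a1 N * of_int x * of_int y + a3 N * of_int y)
       - ((of_int x) ^ 3 + a2 N * (of_int x)\<^sup>2 + a4 N * of_int x + a6 N)) / of_nat p)"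
    if "N = M \<or> N = M'" for x y N
  proof -
    have "p_integral p ((of_int y)\<^sup>2 + a1 N * of_int x * of_int y + a3 N * of_int y)"
      "p_integral p ((of_int x) ^ 3 + a2 N * (of_int x)\<^sup>2 + a4 N * of_int x + a6 N)"
      using that iM iM' by (auto intro!: I)
    then show ?thesis unfolding A_def using rat_cong_iff[OF p(1)] by simp
  qed
  have sub: "f ` A M' \<subseteq> A M"
  proof
    fix P assume "P \<in> f ` A M'"
    then obtain x y where xy: "(x, y) \<in> A M'" "P = f (x, y)" by auto
    define x1 y1 where "x1 = res_mod p (X x)" and "y1 = res_mod p (Y x y)"
    have x1: "x1 \<in> {0..<int p}" "rat_cong p (of_int x1) (X x)"
      and y1: "y1 \<in> {0..<int p}" "rat_cong p (of_int y1) (Y x y)"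
      using res_mod[OF p(1) iX] res_mod[OF p(1) iY] unfolding x1_def y1_def by auto
    obtain z w where z: "p_integral p z" "of_int x1 = X x + of_nat p * z"
      and w: "p_integral p w" "of_int y1 = Y x y + of_nat p * w"
      using x1(2) y1(2) unfolding rat_cong_def by (metis add.commute diff_eq_eq)
    define F' where "F' = (((of_int y)\<^sup>2 + a1 M' * of_int x * of_int y + a3 M' * of_int y)
       - ((of_int x) ^ 3 + a2 M' * (of_int x)\<^sup>2 + a4 M' * of_int x + a6 M') :: rat)"
    have iF': "p_integral p (F' / of_nat p)" using xy(1) mem[of M'] unfolding F'_def by blast
    define F where "F = (((Y x y)\<^sup>2 + a1 M * X x * Y x y + a3 M * Y x y)
       - ((X x) ^ 3 + a2 M * (X x)\<^sup>2 + a4 M * X x + a6 M) :: rat)"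
    have "u ^ 6 * F' = (u ^ 3 * of_int y)\<^sup>2 + (u * a1 M') * (u ^ 2 * of_int x) * (u ^ 3 * of_int y) + (u ^ 3 * a3 M') * (u ^ 3 * of_int y)
      - ((u ^ 2 * of_int x) ^ 3 + (u ^ 2 * a2 M') * (u ^ 2 * of_int x)\<^sup>2 + (u ^ 4 * a4 M') * (u ^ 2 * of_int x) + u ^ 6 * a6 M')"
      unfolding F'_def by algebra
    also have "\<dots> = F" unfolding e F_def X_def Y_def by algebra
    finally have FF: "F = u ^ 6 * F'" ..
    define G where "G = (((of_int y1)\<^sup>2 + a1 M * of_int x1 * of_int y1 + a3 M * of_int y1)
       - ((of_int x1) ^ 3 + a2 M * (of_int x1)\<^sup>2 + a4 M * of_int x1 + a6 M) :: rat)"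
    define H where "H = 2 * Y x y * w + of_nat p * w ^ 2 + a1 M * (X x * w + Y x y * z + of_nat p * z * w) + a3 M * w
      - (3 * X x ^ 2 * z + 3 * X x * of_nat p * z ^ 2 + of_nat p ^ 2 * z ^ 3 + a2 M * (2 * X x * z + of_nat p * z ^ 2) + a4 M * z)"
    have GH: "G = F + of_nat p * H"
      unfolding G_def F_def H_def z(2) w(2) by algebra
    have ip: "p_integral p (of_nat p)" using p_integral_of_int[OF p(1), of "int p"] by simp
    have "p_integral p H" unfolding H_def by (intro I ip iX iY z w iM)
    moreover have "p_integral p (u ^ 6 * (F' / of_nat p))" by (intro I iF' u)
    ultimately have "p_integral p (u ^ 6 * (F' / of_nat p) + H)" using I(4) by metis
    moreover have "G / of_nat p = u ^ 6 * (F' / of_nat p) + H"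
      unfolding GH FF using pp by (simp add: field_simps)
    ultimately have "p_integral p (G / of_nat p)" by simp
    then have "(x1, y1) \<in> A M" using mem[of M] x1(1) y1(1) unfolding G_def by blast
    then show "P \<in> A M" using xy(2) unfolding f_def x1_def y1_def by simp
  qed
  have inj: "inj_on f (A M')"
  proof (rule inj_onI, clarify)
    fix x y x2 y2 assume a: "(x, y) \<in> A M'" "(x2, y2) \<in> A M'" "f (x, y) = f (x2, y2)"
    have rng: "x \<in> {0..<int p}" "y \<in> {0..<int p}" "x2 \<in> {0..<int p}" "y2 \<in> {0..<int p}"
      using a mem[of M'] by blast+
    have eqs: "res_mod p (X x) = res_mod p (X x2)" "res_mod p (Y x y) = res_mod p (Y x2 y2)"
      using a(3) unfolding f_def by auto
    have tr: "p_integral p ((a - b) / of_nat p)"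
      if h: "p_integral p a" "p_integral p b" "res_mod p a = res_mod p b" for a b
    proof -
      have "p_integral p ((of_int (res_mod p a) - a) / of_nat p)"
        "p_integral p ((of_int (res_mod p a) - b) / of_nat p)"
        using res_mod[OF p(1) h(1)] res_mod[OF p(1) h(2)] h(3)
          rat_cong_iff[OF p(1) I(1) h(1)] rat_cong_iff[OF p(1) I(1) h(2)] by auto
      then have "p_integral p ((of_int (res_mod p a) - b) / of_nat p - (of_int (res_mod p a) - a) / of_nat p)"
        using I(6) by presburger
      then show ?thesis by (simp add: diff_divide_distrib)
    qed
    have eqint: "m = n" if h: "p_integral p ((of_int m - of_int n) / of_nat p)" "m \<in> {0..<int p}" "n \<in> {0..<int p}" for m n
    proof -
      have "rat_cong p (of_int m) (of_int n)" using h(1) rat_cong_iff[OF p(1) I(1) I(1)] by blast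
      then have "int p dvd m - n" using rat_cong_of_int[OF p(1)] by blast
      then show ?thesis using h(2,3)
        by (metis atLeastLessThan_iff mod_eq_dvd_iff mod_pos_pos_trivial)
    qed
    have "p_integral p ((1 / u) ^ 2 * ((X x - X x2) / of_nat p))"
      by (intro I u' tr iX eqs)
    moreover have "(1 / u) ^ 2 * ((X x - X x2) / of_nat p) = (of_int x - of_int x2) / of_nat p"
      unfolding X_def using u0 pp by (simp add: field_simps)
    ultimately have xx: "x = x2" using eqint rng by metis
    have "p_integral p ((1 / u) ^ 3 * ((Y x y - Y x2 y2) / of_nat p))"
      by (intro I u' tr iY eqs)
    moreover have "(1 / u) ^ 3 * ((Y x y - Y x2 y2) / of_nat p) = (of_int y - of_int y2) / of_nat p"
      unfolding Y_def xx using u0 pp by (simp add: field_simps)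
    ultimately have "y = y2" using eqint rng by metis
    with xx show "x = x2 \<and> y = y2" by simp
  qed
  have "card (A M') \<le> card (A M)" using inj sub fin card_inj_on_le by blast
  then show ?thesis using card by simp
qed

lemma frob_trace_eq:
  assumes "prime p" "p \<ge> 5" "good_model p W M"
  shows "frob_trace p W = int p + 1 - int (card (reduction_points p M))"
proof -
  have "good_model p W (SOME M. good_model p W M)" using assms(3) by (rule someI)
  then have "card (reduction_points p (SOME M. good_model p W M)) = card (reduction_points p M)"
    using good_model_card_le assms by (meson le_antisym)
  then show ?thesis unfolding frob_trace_def by simp
qed

end

theory Submission
  imports Defs "HOL-Number_Theory.Cong"
begin

text \<open>Put \<open>\<theta> = q d/dq\<close>, \<open>\<kappa> = E6/E4\<close>, \<open>\<mu> = E4\<^sup>2/E6\<close> and \<open>w = 1 - 1728/j = \<kappa>/\<mu>\<close>, and let \<open>S(w)\<close> be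
  the sum of \<open>(w x\<^sup>3 - 27 (x + 2))\<^sup>m\<close> over \<open>x < p\<close>, where \<open>m = (p - 1)/2\<close>. By Euler's criterion,
  \<open>- S(w)\<close> is modulo \<open>p\<close> the Frobenius trace of a curve with \<open>j\<close>-invariant \<open>1728/(1 - w)\<close>.
  Ramanujan's differential equations turn the Picard--Fuchs equation of this family, reduced modulo
  \<open>p\<close>, into the statement that \<open>\<theta>\<^sup>2\<close> annihilates \<open>\<mu>\<^sup>m S(w)\<close> modulo \<open>p\<close>. Hence this
  series is a constant modulo \<open>p\<close> and \<open>q\<^sup>p\<close>, and the cusp shows that its square is \<open>1\<close>. As \<open>\<mu>\<^sup>p\<close>
  is congruent to \<open>1\<close>, it follows that \<open>\<mu>\<close> is congruent to \<open>S(w)\<^sup>2\<close> and that \<open>E4 = \<kappa> \<mu>\<close> is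
  congruent to \<open>\<kappa> R(1/j)\<close> modulo \<open>p\<close> and \<open>q\<^sup>p\<close> for the polynomial \<open>R(t) = S(1 - 1728 t)\<^sup>2\<close> of
  degree less than \<open>p\<close>. Since \<open>\<kappa> j\<^sup>-\<^sup>n\<close> is \<open>\<theta>(j\<^sup>-\<^sup>n)/n\<close>, its \<open>p\<close>-th coefficient vanishes modulo \<open>p\<close>
  unless \<open>n = p\<close>, so that the \<open>p\<close>-th coefficient of \<open>E4/(j - c)\<close>, the sum of the series
  \<open>c\<^sup>n E4 j\<^sup>-\<^sup>n\<^sup>-\<^sup>1\<close>, is congruent to \<open>c\<^sup>p\<^sup>-\<^sup>1 R(1/c)\<close>, which is the square of a Frobenius trace.\<close>

section \<open>Ramanujan's differential equations\<close>

definition quads :: "nat \<Rightarrow> (nat \<times> nat \<times> nat \<times> nat) set" where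
  "quads n = {(a, b, x, y). 0 < a \<and> 0 < b \<and> 0 < x \<and> 0 < y \<and> a * x + b * y = n}"

lemma finite_quads: "finite (quads n)"
proof (rule finite_subset)
  show "quads n \<subseteq> {..n} \<times> {..n} \<times> {..n} \<times> {..n}"
  proof (clarsimp simp: quads_def)
    fix a b x y :: nat assume "0 < a" "0 < b" "0 < x" "0 < y"
    then have "a \<le> a * x" "x \<le> a * x" "b \<le> b * y" "y \<le> b * y" by auto
    then show "a \<le> a * x + b * y \<and> b \<le> a * x + b * y \<and> x \<le> a * x + b * y \<and> y \<le> a * x + b * y"
      by linarith
  qed
qed auto

lemma sum_quads_swap:
  "(\<Sum>(a, b, x, y)\<in>quads n. f a b x y) = (\<Sum>(a, b, x, y)\<in>quads n. f b a y x)"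
  by (rule sum.reindex_bij_witness[where i = "\<lambda>(a, b, x, y). (b, a, y, x)"
        and j = "\<lambda>(a, b, x, y). (b, a, y, x)"]) (auto simp: quads_def)

text \<open>Skoruppa's bijection: \<open>a x + b y = a (x - y) + (a + b) y\<close>.\<close>

lemma sum_quads_shear:
  fixes F :: "nat \<Rightarrow> nat \<Rightarrow> 'a :: comm_monoid_add"
  shows "(\<Sum>(a, b, x, y)\<in>{(a, b, x, y)\<in>quads n. y < x}. F a b) =
         (\<Sum>(a, b, x, y)\<in>{(a, b, x, y)\<in>quads n. a < b}. F a (b - a))"
proof (rule sum.reindex_bij_witness[where i = "\<lambda>(a, b, x, y). (a, b - a, x + y, y)"
        and j = "\<lambda>(a, b, x, y). (a, a + b, x - y, y)"], goal_cases)
  case (2 q)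
  then obtain a b x y where q: "q = (a, b, x, y)" "0 < a" "0 < b" "0 < y" "y < x" "a * x + b * y = n"
    by (auto simp: quads_def)
  then obtain z where "x = y + z" "0 < z" using less_imp_add_positive by blast
  with q show ?case by (auto simp: quads_def algebra_simps)
next
  case (4 q)
  then obtain a b x y where q: "q = (a, b, x, y)" "0 < a" "0 < x" "0 < y" "a < b" "a * x + b * y = n"
    by (auto simp: quads_def)
  then obtain z where "b = a + z" "0 < z" using less_imp_add_positive by blast
  with q show ?case by (auto simp: quads_def algebra_simps)
qed (auto simp: quads_def)

text \<open>If \<open>x = y\<close>, then \<open>(a + b) * x = n\<close>, so that
  \<open>d = a + b\<close> is a divisor of \<open>n\<close> and \<open>a\<close> runs freely below
  it.\<close>

lemma sum_quads_diag_right: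
  fixes F :: "nat \<Rightarrow> nat \<Rightarrow> 'a :: comm_monoid_add"
  assumes "n > 0"
  shows "(\<Sum>(a, b, x, y)\<in>{(a, b, x, y)\<in>quads n. x = y}. F a b) =
         (\<Sum>d | d dvd n. \<Sum>a = 1..<d. F a (d - a))"
proof -
  have "(\<Sum>(a, b, x, y)\<in>{(a, b, x, y)\<in>quads n. x = y}. F a b) =
      (\<Sum>(d, a)\<in>Sigma {d. d dvd n} (\<lambda>d. {1..<d}). F a (d - a))"
  proof (rule sum.reindex_bij_witness[where i = "\<lambda>(d, a). (a, d - a, n div d, n div d)"
        and j = "\<lambda>(a, b, x, y). (a + b, a)"], goal_cases)
    case (1 q)
    then obtain a b x where q: "q = (a, b, x, x)" "0 < a" "0 < b" "0 < x" "n = (a + b) * x"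
      by (auto simp: quads_def add_mult_distrib)
    then have "n div (a + b) = x" by simp
    with q show ?case by simp
  next
    case (2 q)
    then obtain a b x where q: "q = (a, b, x, x)" "0 < a" "0 < b" "0 < x" "n = (a + b) * x"
      by (auto simp: quads_def add_mult_distrib)
    then show ?case by simp
  next
    case (4 q)
    then obtain d a e where q: "q = (d, a)" "1 \<le> a" "a < d" "n = d * e" by auto
    with assms have "0 < e" by (simp add: Nat.gr0I)
    moreover obtain b where "d = a + b" "0 < b" using q less_imp_add_positive by blast
    moreover from calculation q(4) have "n div d = e" by simp
    ultimately show ?case using q by (simp add: quads_def add_mult_distrib)
  qed (auto simp: quads_def)
  also have "\<dots> = (\<Sum>d | d dvd n. \<Sum>a = 1..<d. F a (d - a))"
    using assms by (subst sum.Sigma) auto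
  finally show ?thesis .
qed

text \<open>If \<open>a = b = d\<close>, then \<open>x + y = n div d\<close>, which has
  \<open>n div d - 1\<close> solutions in positive numbers.\<close>

lemma sum_quads_diag_left:
  fixes F :: "nat \<Rightarrow> 'a :: semiring_1"
  assumes "n > 0"
  shows "(\<Sum>(a, b, x, y)\<in>{(a, b, x, y)\<in>quads n. a = b}. F a) =
         (\<Sum>d | d dvd n. of_nat (n div d - 1) * F d)"
proof -
  have "(\<Sum>(a, b, x, y)\<in>{(a, b, x, y)\<in>quads n. a = b}. F a) =
      (\<Sum>(d, x)\<in>Sigma {d. d dvd n} (\<lambda>d. {1..<n div d}). F d)"
  proof (rule sum.reindex_bij_witness[where i = "\<lambda>(d, x). (d, d, x, n div d - x)"
        and j = "\<lambda>(a, b, x, y). (a, x)"], goal_cases)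
    case (1 q)
    then obtain a x y where q: "q = (a, a, x, y)" "0 < a" "0 < x" "0 < y" "n = a * (x + y)"
      by (auto simp: quads_def add_mult_distrib2)
    then have "n div a = x + y" by simp
    with q show ?case by simp
  next
    case (2 q)
    then obtain a x y where q: "q = (a, a, x, y)" "0 < a" "0 < x" "0 < y" "n = a * (x + y)"
      by (auto simp: quads_def add_mult_distrib2)
    then show ?case by simp
  next
    case (4 q)
    then obtain d x where q: "q = (d, x)" "d dvd n" "1 \<le> x" "x < n div d" by auto
    from q(2) obtain e where q2: "n = d * e" ..
    with assms have "0 < d" by (simp add: Nat.gr0I)
    with q q2 have "x < e" by simp
    then obtain y where "e = x + y" "0 < y" using less_imp_add_positive by blast
    then show ?case using q q2 \<open>0 < d\<close> by (simp add: quads_def add_mult_distrib2)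
  qed (auto simp: quads_def)
  also have "\<dots> = (\<Sum>d | d dvd n. of_nat (n div d - 1) * F d)"
    using assms by (subst sum.Sigma[symmetric]) auto
  finally show ?thesis .
qed

text \<open>The sum of \<open>F a b\<close> is split by comparing \<open>x\<close> with
  \<open>y\<close>, that of \<open>F a (b - a)\<close> by comparing \<open>a\<close> with
  \<open>b\<close>. The symmetry conditions make the two off-diagonal parts of each sum equal, and
  the shear identifies the part \<open>y < x\<close> of the first with the part \<open>a < b\<close>
  of the second. The difference therefore consists of the two diagonals only.\<close>

lemma sum_quads_symmetric:
  fixes F :: "rat \<Rightarrow> rat \<Rightarrow> rat"
  assumes n: "n > 0"
    and F: "\<And>u v. F u v = F v u"
    and F': "\<And>u v. F u (v - u) = F v (u - v)"
  shows "(\<Sum>(a, b, x, y)\<in>quads n. F (of_nat a) (of_nat b) - F (of_nat a) (of_nat b - of_nat a)) =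
    (\<Sum>d | d dvd n. (\<Sum>a = 1..<d. F (of_nat a) (of_nat d - of_nat a))
       - (of_nat (n div d) - 1) * F (of_nat d) 0)"
proof -
  define G where "G = (\<lambda>a b :: nat. F (of_nat a) (of_nat b))"
  define H where "H = (\<lambda>a b :: nat. F (of_nat a) (of_nat b - of_nat a))"
  let ?S = "\<lambda>P f. \<Sum>(a, b, x, y)\<in>{(a, b, x, y)\<in>quads n. P a b x y}. f a b :: rat"
  have split: "(\<Sum>(a, b, x, y)\<in>quads n. f a b) = ?S P f + ?S Q f + ?S R f"
    if "\<And>a b x y. (P a b x y \<or> Q a b x y \<or> R a b x y) \<and> \<not> (P a b x y \<and> Q a b x y)
      \<and> \<not> (P a b x y \<and> R a b x y) \<and> \<not> (Q a b x y \<and> R a b x y)" for P Q R f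
  proof -
    let ?A = "\<lambda>P. {(a, b, x, y)\<in>quads n. P a b x y}"
    have fin: "finite (?A P)" for P
      by (rule finite_subset[OF _ finite_quads[of n]]) auto
    have "quads n = ?A P \<union> ?A Q \<union> ?A R" using that by fast
    moreover have "?A P \<inter> ?A Q = {}" "(?A P \<union> ?A Q) \<inter> ?A R = {}" using that by fast+
    ultimately show ?thesis using fin
      by (metis (no_types, lifting) finite_UnI sum.union_disjoint)
  qed
  have swap: "?S P f = ?S (\<lambda>a b x y. P b a y x) (\<lambda>a b. f b a)" for P f
    by (rule sum.reindex_bij_witness[where i = "\<lambda>(a, b, x, y). (b, a, y, x)"
        and j = "\<lambda>(a, b, x, y). (b, a, y, x)"]) (auto simp: quads_def)
  have G: "G b a = G a b" and H: "H b a = H a b" for a b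
    using F F' by (auto simp: G_def H_def)
  have shear: "?S (\<lambda>a b x y. y < x) G = ?S (\<lambda>a b x y. a < b) H"
    unfolding sum_quads_shear[of G]
    by (rule sum.cong) (auto simp: G_def H_def of_nat_diff)
  have "(\<Sum>(a, b, x, y)\<in>quads n. G a b) = 2 * ?S (\<lambda>a b x y. y < x) G + ?S (\<lambda>a b x y. x = y) G"
  proof -
    have "(\<Sum>(a, b, x, y)\<in>quads n. G a b) = ?S (\<lambda>a b x y. y < x) G + ?S (\<lambda>a b x y. x < y) G + ?S (\<lambda>a b x y. x = y) G"
      by (rule split) auto
    moreover have "?S (\<lambda>a b x y. x < y) G = ?S (\<lambda>a b x y. y < x) G"
      using swap[where P = "\<lambda>a b x y. x < y" and f = G] by (simp only: G)
    ultimately show ?thesis by linarith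
  qed
  moreover have "(\<Sum>(a, b, x, y)\<in>quads n. H a b) = 2 * ?S (\<lambda>a b x y. a < b) H + ?S (\<lambda>a b x y. a = b) H"
  proof -
    have "(\<Sum>(a, b, x, y)\<in>quads n. H a b) = ?S (\<lambda>a b x y. a < b) H + ?S (\<lambda>a b x y. b < a) H + ?S (\<lambda>a b x y. a = b) H"
      by (rule split) auto
    moreover have "?S (\<lambda>a b x y. b < a) H = ?S (\<lambda>a b x y. a < b) H"
      using swap[where P = "\<lambda>a b x y. b < a" and f = H] by (simp only: H)
    ultimately show ?thesis by linarith
  qed
  moreover have "?S (\<lambda>a b x y. x = y) G = (\<Sum>d | d dvd n. \<Sum>a = 1..<d. F (of_nat a) (of_nat d - of_nat a))"
    unfolding sum_quads_diag_right[OF n] by (intro sum.cong) (auto simp: G_def of_nat_diff)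
  moreover have "?S (\<lambda>a b x y. a = b) H = (\<Sum>d | d dvd n. (of_nat (n div d) - 1) * F (of_nat d) 0)"
  proof -
    have "?S (\<lambda>a b x y. a = b) H = ?S (\<lambda>a b x y. a = b) (\<lambda>a b. F (of_nat a) 0)"
      by (rule sum.cong) (auto simp: H_def)
    also have "\<dots> = (\<Sum>d | d dvd n. of_nat (n div d - 1) * F (of_nat d) 0)"
      by (rule sum_quads_diag_left[OF n])
    also have "\<dots> = (\<Sum>d | d dvd n. (of_nat (n div d) - 1) * F (of_nat d) 0)"
    proof (rule sum.cong, goal_cases)
      case (2 d)
      then have "1 \<le> n div d" using n by (auto elim!: dvdE)
      then show ?case by (simp add: of_nat_diff)
    qed simp
    finally show ?thesis .
  qed
  moreover have lhs: "(\<Sum>(a, b, x, y)\<in>quads n. F (of_nat a) (of_nat b) - F (of_nat a) (of_nat b - of_nat a)) =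
    (\<Sum>(a, b, x, y)\<in>quads n. G a b) - (\<Sum>(a, b, x, y)\<in>quads n. H a b)"
    by (simp add: sum_subtractf split_def G_def H_def)
  ultimately show ?thesis
    unfolding lhs sum_subtractf using shear by linarith
qed

section \<open>Convolutions of divisor sums\<close>

definition div_series :: "nat \<Rightarrow> rat fps" where
  "div_series k = Abs_fps (\<lambda>n. of_nat (sigma_sum k n))"

definition theta :: "'a :: comm_ring_1 fps \<Rightarrow> 'a fps" where
  "theta f = fps_X * fps_deriv f"

lemma theta_nth: "theta f $ n = of_nat n * f $ n"
  by (cases n) (auto simp: theta_def)

lemma sigma_sum_0 [simp]: "sigma_sum k 0 = 0"
  by (simp add: sigma_sum_def)

text \<open>A divisor \<open>a\<close> of \<open>i\<close> and a divisor \<open>b\<close> of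
  \<open>n - i\<close> correspond to a quadruple with \<open>a * x = i\<close> and
  \<open>b * y = n - i\<close>.\<close>

lemma div_series_mult_nth:
  "(div_series k * div_series l) $ n = (\<Sum>(a, b, x, y)\<in>quads n. of_nat a ^ k * of_nat b ^ l)"
proof -
  let ?I = "Sigma {0<..<n} (\<lambda>i. {a. a dvd i} \<times> {b. b dvd n - i})"
  have "(div_series k * div_series l) $ n = (\<Sum>i = 0..n. of_nat (sigma_sum k i) * of_nat (sigma_sum l (n - i)))"
    by (simp add: fps_mult_nth div_series_def)
  also have "\<dots> = (\<Sum>i\<in>{0<..<n}. of_nat (sigma_sum k i) * of_nat (sigma_sum l (n - i)))"
  proof (rule sum.mono_neutral_right)
    show "\<forall>i\<in>{0..n} - {0<..<n}. of_nat (sigma_sum k i) * of_nat (sigma_sum l (n - i)) = (0 :: rat)"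
    proof
      fix i assume "i \<in> {0..n} - {0<..<n}"
      then have "i = 0 \<or> i = n" by auto
      then show "of_nat (sigma_sum k i) * of_nat (sigma_sum l (n - i)) = (0 :: rat)" by auto
    qed
  qed auto
  also have "\<dots> = (\<Sum>i\<in>{0<..<n}. \<Sum>(a, b)\<in>{a. a dvd i} \<times> {b. b dvd n - i}. of_nat a ^ k * of_nat b ^ l)"
    by (simp add: sigma_sum_def sum_product sum.cartesian_product)
  also have "\<dots> = (\<Sum>(i, a, b)\<in>?I. of_nat a ^ k * of_nat b ^ l)"
    by (subst sum.Sigma) auto
  also have "\<dots> = (\<Sum>(a, b, x, y)\<in>quads n. of_nat a ^ k * of_nat b ^ l)"
  proof (rule sum.reindex_bij_witness[where i = "\<lambda>(a, b, x, y). (a * x, a, b)"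
        and j = "\<lambda>(i, a, b). (a, b, i div a, (n - i) div b)"], goal_cases)
    case (2 q)
    then obtain i a b where q: "q = (i, a, b)" "0 < i" "i < n" "a dvd i" "b dvd n - i" by auto
    then obtain x y where xy: "i = a * x" "n - i = b * y" by (auto elim!: dvdE)
    with q have "0 < a" "0 < x" "0 < b" "0 < y" by (auto intro!: Nat.gr0I)
    then have "i div a = x" "(n - i) div b = y" using xy by auto
    moreover have "a * x + b * y = n" using xy q by linarith
    ultimately show ?case using q \<open>0 < a\<close> \<open>0 < b\<close> \<open>0 < x\<close> \<open>0 < y\<close> by (simp add: quads_def)
  next
    case (3 q)
    then show ?case by (auto simp: quads_def)
  next
    case (4 q)
    then show ?case by (auto simp: quads_def)
  qed auto
  finally show ?thesis .
qed

lemma sum_powers: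
  fixes N :: nat
  shows "(\<Sum>a<N. (of_nat a :: rat)) = of_nat N ^ 2 / 2 - of_nat N / 2"
    and "(\<Sum>a<N. (of_nat a :: rat) ^ 2) = of_nat N ^ 3 / 3 - of_nat N ^ 2 / 2 + of_nat N / 6"
    and "(\<Sum>a<N. (of_nat a :: rat) ^ 3) = of_nat N ^ 4 / 4 - of_nat N ^ 3 / 2 + of_nat N ^ 2 / 4"
    and "(\<Sum>a<N. (of_nat a :: rat) ^ 4) = of_nat N ^ 5 / 5 - of_nat N ^ 4 / 2 + of_nat N ^ 3 / 3 - of_nat N / 30"
    and "(\<Sum>a<N. (of_nat a :: rat) ^ 5) = of_nat N ^ 6 / 6 - of_nat N ^ 5 / 2 + 5 * of_nat N ^ 4 / 12 - of_nat N ^ 2 / 12"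
    and "(\<Sum>a<N. (of_nat a :: rat) ^ 6) = of_nat N ^ 7 / 7 - of_nat N ^ 6 / 2 + of_nat N ^ 5 / 2 - of_nat N ^ 3 / 6 + of_nat N / 42"
  by (induction N; simp add: field_simps power_numeral_reduce)+

text \<open>The summands are \<open>u^2 + u v + v^2\<close>, its square and cube, and
  \<open>(u v (u + v))^2\<close> at \<open>u = a\<close>, \<open>v = d - a\<close>. These are the
  inner divisor sums that the invariant forms below produce.\<close>

lemma sum_forms:
  fixes d :: nat
  defines "D \<equiv> of_nat d :: rat"
  shows "(\<Sum>a<d. D\<^sup>2 - D * of_nat a + of_nat a ^ 2) = 5 / 6 * D ^ 3 + D / 6"
    and "(\<Sum>a<d. (D\<^sup>2 - D * of_nat a + of_nat a ^ 2) ^ 2) = 7 / 10 * D ^ 5 + D ^ 3 / 3 - D / 30"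
    and "(\<Sum>a<d. (D\<^sup>2 - D * of_nat a + of_nat a ^ 2) ^ 3) = 83 / 140 * D ^ 7 + D ^ 5 / 2 - 7 / 60 * D ^ 3 + D / 42"
    and "(\<Sum>a<d. (of_nat a * (D - of_nat a) * D) ^ 2) = (D ^ 7 - D ^ 3) / 30"
proof -
  have 0: "(D\<^sup>2 - D * x + x ^ 2) ^ 2 = D ^ 4 - 2 * D ^ 3 * x + 3 * D ^ 2 * x ^ 2 - 2 * D * x ^ 3 + x ^ 4"
    "(D\<^sup>2 - D * x + x ^ 2) ^ 3 = D ^ 6 - 3 * D ^ 5 * x + 6 * D ^ 4 * x ^ 2 - 7 * D ^ 3 * x ^ 3
      + 6 * D ^ 2 * x ^ 4 - 3 * D * x ^ 5 + x ^ 6"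
    "(x * (D - x) * D) ^ 2 = D ^ 4 * x ^ 2 - 2 * D ^ 3 * x ^ 3 + D ^ 2 * x ^ 4" for x
    by algebra+
  note S = sum.distrib sum_subtractf sum_distrib_left[symmetric] sum_powers
  show "(\<Sum>a<d. D\<^sup>2 - D * of_nat a + of_nat a ^ 2) = 5 / 6 * D ^ 3 + D / 6"
    by (simp only: S sum_constant card_lessThan flip: D_def, simp add: field_simps power_numeral_reduce)
  show "(\<Sum>a<d. (D\<^sup>2 - D * of_nat a + of_nat a ^ 2) ^ 2) = 7 / 10 * D ^ 5 + D ^ 3 / 3 - D / 30"
    unfolding 0 by (simp only: S sum_constant card_lessThan flip: D_def, simp add: field_simps power_numeral_reduce)
  show "(\<Sum>a<d. (D\<^sup>2 - D * of_nat a + of_nat a ^ 2) ^ 3) = 83 / 140 * D ^ 7 + D ^ 5 / 2 - 7 / 60 * D ^ 3 + D / 42"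
    unfolding 0 by (simp only: S sum_constant card_lessThan flip: D_def, simp add: field_simps power_numeral_reduce)
  show "(\<Sum>a<d. (of_nat a * (D - of_nat a) * D) ^ 2) = (D ^ 7 - D ^ 3) / 30"
    unfolding 0 by (simp only: S sum_constant card_lessThan flip: D_def, simp add: field_simps power_numeral_reduce)
qed

text \<open>The missing term \<open>a = 0\<close> of the inner sum equals \<open>F d 0\<close> and
  absorbs the \<open>1\<close> in \<open>n / d - 1\<close>. What remains of the other diagonal is
  \<open>(n / d) * F d 0 = n * E d\<close>; its factor \<open>n\<close> later becomes the operator
  \<open>theta\<close>.\<close>

lemma sum_quads_eq_divisor_sum:
  fixes F :: "rat \<Rightarrow> rat \<Rightarrow> rat"
  assumes n: "n > 0"
    and F: "\<And>u v. F u v = F v u"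
    and F': "\<And>u v. F u (v - u) = F v (u - v)"
    and E: "\<And>u. F u 0 = u * E u"
  shows "(\<Sum>(a, b, x, y)\<in>quads n. F (of_nat a) (of_nat b) - F (of_nat a) (of_nat b - of_nat a)) =
    (\<Sum>d | d dvd n. (\<Sum>a<d. F (of_nat a) (of_nat d - of_nat a)) - of_nat n * E (of_nat d))"
  unfolding sum_quads_symmetric[of n F, OF n F F']
proof (rule sum.cong, goal_cases)
  case (2 d)
  then obtain e where e: "n = d * e" by auto
  with n have d: "d > 0" by (simp add: Nat.gr0I)
  then have "{..<d} = insert 0 {1..<d}" by auto
  then have "(\<Sum>a<d. F (of_nat a) (of_nat d - of_nat a)) =
      F (of_nat d) 0 + (\<Sum>a = 1..<d. F (of_nat a) (of_nat d - of_nat a))"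
    using F[of 0] by simp
  then show ?case using d by (simp add: e E algebra_simps)
qed simp

lemma div_series_nth: "div_series k $ n = (\<Sum>d | d dvd n. of_nat d ^ k)"
  by (simp add: div_series_def sigma_sum_def)

text \<open>With \<open>Q = u^2 + u v + v^2\<close>, the forms \<open>Q\<close>, \<open>Q^2\<close>,
  \<open>(u v (u + v))^2\<close> and \<open>Q^3\<close> satisfy both symmetry conditions. Their
  differences between \<open>(a, b)\<close> and \<open>(a, b - a)\<close> are \<open>2 a b\<close>,
  \<open>4 (a^3 b + a b^3)\<close>, \<open>4 a^3 b^3\<close> and
  \<open>6 (a^5 b + a b^5) + 14 a^3 b^3\<close>, which are the required convolutions.\<close>

lemma div_series_convolutions:
  shows "12 * div_series 1 ^ 2 = 5 * div_series 3 + div_series 1 - 6 * theta (div_series 1)"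
    and "240 * (div_series 1 * div_series 3) =
      21 * div_series 5 + 10 * div_series 3 - div_series 1 - 30 * theta (div_series 3)"
    and "120 * div_series 3 ^ 2 = div_series 7 - div_series 3"
    and "504 * (div_series 1 * div_series 5) =
      20 * div_series 7 + 21 * div_series 5 + div_series 1 - 42 * theta (div_series 5)"
proof -
  let ?s = "\<lambda>k n. \<Sum>d | d dvd n. (of_nat d :: rat) ^ k"
  let ?Q = "\<lambda>n k l. \<Sum>(a, b, x, y)\<in>quads n. (of_nat a :: rat) ^ k * of_nat b ^ l"
  have sym: "?Q n k l = ?Q n l k" for n k l
    using sum_quads_swap[of "\<lambda>a b x y. (of_nat a :: rat) ^ k * of_nat b ^ l" n] by (simp add: mult.commute)
  note S = sum.distrib sum_subtractf sum_distrib_left[symmetric]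
  have 1: "2 * ?Q n 1 1 = 5 / 6 * ?s 3 n + 1 / 6 * ?s 1 n - of_nat n * ?s 1 n" if n: "n > 0" for n
  proof -
    have "2 * ?Q n 1 1 = (\<Sum>(a, b, x, y)\<in>quads n. 2 * (of_nat a ^ 1 * of_nat b ^ 1))"
      by (simp add: sum_distrib_left split_def)
    also have "\<dots> = (\<Sum>d | d dvd n. (\<Sum>a<d. (of_nat d)\<^sup>2 - of_nat d * of_nat a + of_nat a ^ 2) - of_nat n * of_nat d)"
      using sum_quads_eq_divisor_sum[of n "\<lambda>u v. u ^ 2 + u * v + v ^ 2" "\<lambda>u. u", OF n]
      by (simp add: algebra_simps power2_eq_square)
    also have "\<dots> = 5 / 6 * ?s 3 n + 1 / 6 * ?s 1 n - of_nat n * ?s 1 n"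
      unfolding sum_forms by (simp add: S sum_divide_distrib[symmetric])
    finally show ?thesis .
  qed
  have 2: "8 * ?Q n 1 3 = 7 / 10 * ?s 5 n + 1 / 3 * ?s 3 n - 1 / 30 * ?s 1 n - of_nat n * ?s 3 n" if n: "n > 0" for n
  proof -
    have "8 * ?Q n 1 3 = 4 * ?Q n 1 3 + 4 * ?Q n 3 1" using sym[where n = n and k = 1 and l = 3] by simp
    also have "\<dots> = (\<Sum>(a, b, x, y)\<in>quads n. 4 * (of_nat a ^ 1 * of_nat b ^ 3) + 4 * (of_nat a ^ 3 * of_nat b ^ 1))"
      by (simp add: sum_distrib_left split_def sum.distrib)
    also have "\<dots> = (\<Sum>(a, b, x, y)\<in>quads n. (of_nat a ^ 2 + of_nat a * of_nat b + of_nat b ^ 2) ^ 2 -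
        (of_nat a ^ 2 + of_nat a * (of_nat b - of_nat a) + (of_nat b - of_nat a) ^ 2) ^ 2)"
      by (rule sum.cong) (auto simp: field_simps power_numeral_reduce)
    also have "\<dots> = (\<Sum>d | d dvd n. (\<Sum>a<d. (of_nat a ^ 2 + of_nat a * (of_nat d - of_nat a) + (of_nat d - of_nat a) ^ 2) ^ 2) - of_nat n * of_nat d ^ 3)"
      by (rule sum_quads_eq_divisor_sum[of n "\<lambda>u v. (u ^ 2 + u * v + v ^ 2) ^ 2" "\<lambda>u. u ^ 3", OF n])
        (auto simp: field_simps power_numeral_reduce)
    also have "\<dots> = (\<Sum>d | d dvd n. (\<Sum>a<d. ((of_nat d)\<^sup>2 - of_nat d * of_nat a + of_nat a ^ 2) ^ 2) - of_nat n * of_nat d ^ 3)"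
      by (intro sum.cong arg_cong2[of _ _ _ _ "(-)"] arg_cong2[of _ _ _ _ "(^)"]) (auto simp: field_simps power_numeral_reduce)
    also have "\<dots> = 7 / 10 * ?s 5 n + 1 / 3 * ?s 3 n - 1 / 30 * ?s 1 n - of_nat n * ?s 3 n"
      unfolding sum_forms by (simp add: S sum_divide_distrib[symmetric])
    finally show ?thesis .
  qed
  have 3: "4 * ?Q n 3 3 = 1 / 30 * ?s 7 n - 1 / 30 * ?s 3 n" if n: "n > 0" for n
  proof -
    have "4 * ?Q n 3 3 = (\<Sum>(a, b, x, y)\<in>quads n. 4 * (of_nat a ^ 3 * of_nat b ^ 3))"
      by (simp add: sum_distrib_left split_def sum.distrib)
    also have "\<dots> = (\<Sum>(a, b, x, y)\<in>quads n. (of_nat a * of_nat b * (of_nat a + of_nat b)) ^ 2 -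
        (of_nat a * (of_nat b - of_nat a) * (of_nat a + (of_nat b - of_nat a))) ^ 2)"
      by (rule sum.cong) (auto simp: field_simps power_numeral_reduce)
    also have "\<dots> = (\<Sum>d | d dvd n. (\<Sum>a<d. (of_nat a * (of_nat d - of_nat a) * (of_nat a + (of_nat d - of_nat a))) ^ 2) - of_nat n * 0)"
      by (rule sum_quads_eq_divisor_sum[of n "\<lambda>u v. (u * v * (u + v)) ^ 2" "\<lambda>u. 0", OF n])
        (auto simp: field_simps power_numeral_reduce)
    also have "\<dots> = (\<Sum>d | d dvd n. (\<Sum>a<d. (of_nat a * (of_nat d - of_nat a) * of_nat d) ^ 2))"
      by simp
    also have "\<dots> = 1 / 30 * ?s 7 n - 1 / 30 * ?s 3 n"
      unfolding sum_forms by (simp add: S sum_divide_distrib[symmetric] diff_divide_distrib)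
    finally show ?thesis .
  qed
  have 4: "12 * ?Q n 1 5 + 14 * ?Q n 3 3 =
    83 / 140 * ?s 7 n + 1 / 2 * ?s 5 n - 7 / 60 * ?s 3 n + 1 / 42 * ?s 1 n - of_nat n * ?s 5 n" if n: "n > 0" for n
  proof -
    have "12 * ?Q n 1 5 + 14 * ?Q n 3 3 = 6 * ?Q n 1 5 + 6 * ?Q n 5 1 + 14 * ?Q n 3 3" using sym[where n = n and k = 1 and l = 5] by simp
    also have "\<dots> = (\<Sum>(a, b, x, y)\<in>quads n. 6 * (of_nat a ^ 1 * of_nat b ^ 5) + 6 * (of_nat a ^ 5 * of_nat b ^ 1)
        + 14 * (of_nat a ^ 3 * of_nat b ^ 3))"
      by (simp add: sum_distrib_left split_def sum.distrib)
    also have "\<dots> = (\<Sum>(a, b, x, y)\<in>quads n. (of_nat a ^ 2 + of_nat a * of_nat b + of_nat b ^ 2) ^ 3 -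
        (of_nat a ^ 2 + of_nat a * (of_nat b - of_nat a) + (of_nat b - of_nat a) ^ 2) ^ 3)"
      by (rule sum.cong) (auto simp: field_simps power_numeral_reduce)
    also have "\<dots> = (\<Sum>d | d dvd n. (\<Sum>a<d. (of_nat a ^ 2 + of_nat a * (of_nat d - of_nat a) + (of_nat d - of_nat a) ^ 2) ^ 3) - of_nat n * of_nat d ^ 5)"
      by (rule sum_quads_eq_divisor_sum[of n "\<lambda>u v. (u ^ 2 + u * v + v ^ 2) ^ 3" "\<lambda>u. u ^ 5", OF n])
        (auto simp: field_simps power_numeral_reduce)
    also have "\<dots> = (\<Sum>d | d dvd n. (\<Sum>a<d. ((of_nat d)\<^sup>2 - of_nat d * of_nat a + of_nat a ^ 2) ^ 3) - of_nat n * of_nat d ^ 5)"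
      by (intro sum.cong arg_cong2[of _ _ _ _ "(-)"] arg_cong2[of _ _ _ _ "(^)"]) (auto simp: field_simps power_numeral_reduce)
    also have "\<dots> = 83 / 140 * ?s 7 n + 1 / 2 * ?s 5 n - 7 / 60 * ?s 3 n + 1 / 42 * ?s 1 n - of_nat n * ?s 5 n"
      unfolding sum_forms by (simp add: S sum_divide_distrib[symmetric])
    finally show ?thesis .
  qed
  have nth: "(div_series k * div_series l) $ n = ?Q n k l" for k l n
    by (rule div_series_mult_nth)
  have eqI: "f = g" if "f $ 0 = g $ 0" "\<And>n. n > 0 \<Longrightarrow> f $ n = g $ n" for f g :: "rat fps"
    using that by (metis fps_ext neq0_conv)
  have z: "div_series k $ 0 = 0" for k by (simp add: div_series_def)
  have num: "(numeral k * f) $ n = numeral k * f $ n" for k n and f :: "rat fps"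
    by (simp add: numeral_fps_const)
  show "12 * div_series 1 ^ 2 = 5 * div_series 3 + div_series 1 - 6 * theta (div_series 1)"
  proof (rule eqI)
    fix n :: nat assume "n > 0"
    from 1[OF this] show "(12 * div_series 1 ^ 2) $ n = (5 * div_series 3 + div_series 1 - 6 * theta (div_series 1)) $ n"
      unfolding power2_eq_square fps_add_nth fps_sub_nth num nth theta_nth div_series_nth by simp
  qed (simp add: num z theta_nth power2_eq_square)
  show "240 * (div_series 1 * div_series 3) =
      21 * div_series 5 + 10 * div_series 3 - div_series 1 - 30 * theta (div_series 3)"
  proof (rule eqI)
    fix n :: nat assume "n > 0"
    from 2[OF this] show "(240 * (div_series 1 * div_series 3)) $ n =
      (21 * div_series 5 + 10 * div_series 3 - div_series 1 - 30 * theta (div_series 3)) $ n"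
      unfolding power2_eq_square fps_add_nth fps_sub_nth num nth theta_nth div_series_nth by simp
  qed (simp add: num z theta_nth)
  show "120 * div_series 3 ^ 2 = div_series 7 - div_series 3"
  proof (rule eqI)
    fix n :: nat assume "n > 0"
    from 3[OF this] show "(120 * div_series 3 ^ 2) $ n = (div_series 7 - div_series 3) $ n"
      unfolding power2_eq_square fps_add_nth fps_sub_nth num nth theta_nth div_series_nth by simp
  qed (simp add: num z theta_nth power2_eq_square)
  show "504 * (div_series 1 * div_series 5) =
      20 * div_series 7 + 21 * div_series 5 + div_series 1 - 42 * theta (div_series 5)"
  proof (rule eqI)
    fix n :: nat assume "n > 0"
    \<comment> \<open>The cube of \<open>Q\<close> also contributes the convolution of
      \<open>sigma_3\<close> with itself, which the third identity eliminates.\<close>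
    from 3[OF this] 4[OF this] show "(504 * (div_series 1 * div_series 5)) $ n =
      (20 * div_series 7 + 21 * div_series 5 + div_series 1 - 42 * theta (div_series 5)) $ n"
      unfolding power2_eq_square fps_add_nth fps_sub_nth num nth theta_nth div_series_nth by simp
  qed (simp add: num z theta_nth)
qed

section \<open>Eisenstein series\<close>

definition E2 :: "rat fps" where
  "E2 = 1 - 24 * div_series 1"

lemma E4_eq: "E4 = 1 + 240 * div_series 3"
  by (rule fps_ext) (auto simp: E4_def div_series_def numeral_fps_const)

lemma E6_eq: "E6 = 1 - 504 * div_series 5"
  by (rule fps_ext) (auto simp: E6_def div_series_def numeral_fps_const)

lemma ramanujan:
  shows "12 * theta E2 = E2 ^ 2 - E4"
    and "3 * theta E4 = E2 * E4 - E6"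
    and "2 * theta E6 = E2 * E6 - E4 ^ 2"
proof -
  have d: "theta (1 + numeral k * f) = numeral k * theta f" "theta (1 - numeral k * f) = - (numeral k * theta f)"
    for k and f :: "rat fps"
    by (simp_all add: theta_def numeral_fps_const algebra_simps)
  note C = div_series_convolutions
  show "12 * theta E2 = E2 ^ 2 - E4"
    unfolding E2_def E4_eq d using C(1) by algebra
  show "3 * theta E4 = E2 * E4 - E6"
    unfolding E2_def E4_eq E6_eq d using C(2) by algebra
  \<comment> \<open>The third convolution says that \<open>E4 ^ 2 = 1 + 480 * div_series 7\<close>,
    and this cancels the divisor sums of seventh powers in \<open>E2 * E6\<close>.\<close>
  show "2 * theta E6 = E2 * E6 - E4 ^ 2"
    unfolding E2_def E4_eq E6_eq d using C(3,4) by algebra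
qed

section \<open>Congruences modulo a prime\<close>

lemma int_power_prime_cong:
  assumes p: "prime p"
  shows "[int x ^ p = int x] (mod int p)"
proof (induction x)
  case 0
  then show ?case using prime_gt_0_nat[OF p] by (simp add: zero_power)
next
  case (Suc x)
  have p0: "p > 0" using p prime_gt_0_nat by blast
  have "int (Suc x) ^ p = (int x + 1) ^ p" by (simp add: add.commute)
  also have "\<dots> = (\<Sum>k\<le>p. of_nat (p choose k) * int x ^ k)" by (subst binomial_ring) simp
  also have "{..p} = insert 0 (insert p {0<..<p})" using p0 by auto
  also have "(\<Sum>k\<in>\<dots>. of_nat (p choose k) * int x ^ k) =
      1 + int x ^ p + (\<Sum>k\<in>{0<..<p}. of_nat (p choose k) * int x ^ k)"
    using p0 by simp
  finally have eq: "int (Suc x) ^ p = \<dots>" .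
  have "int p dvd of_nat (p choose k) * int x ^ k" if "k \<in> {0<..<p}" for k
    using dvd_choose_prime[of k p] p that by (simp add: dvd_mult2)
  then have "[(\<Sum>k\<in>{0<..<p}. of_nat (p choose k) * int x ^ k) = 0] (mod int p)"
    unfolding cong_0_iff by (rule dvd_sum)
  from cong_add[OF cong_add[OF cong_refl[of 1] Suc] this] show ?case unfolding eq by (simp add: add.commute)
qed

lemma int_fermat:
  fixes n :: int
  assumes p: "prime p" and n: "\<not> int p dvd n"
  shows "[n ^ (p - 1) = 1] (mod int p)"
proof -
  define k where "k = nat (n mod int p)"
  have p0: "p > 0" using p prime_gt_0_nat by blast
  have k: "int k = n mod int p" using p0 by (simp add: k_def)
  have "int p dvd int k ^ p - int k"
    using int_power_prime_cong[OF p, of k] by (simp add: cong_iff_dvd_diff)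
  moreover have "int k ^ p = int k * int k ^ (p - 1)"
    using p0 by (metis power_eq_if neq0_conv)
  ultimately have "int p dvd int k * (int k ^ (p - 1) - 1)"
    by (simp add: algebra_simps)
  moreover have "\<not> int p dvd int k" using n k by (metis dvd_mod_iff dvd_refl)
  ultimately have "[int k ^ (p - 1) = 1] (mod int p)"
    using p by (metis cong_iff_dvd_diff prime_dvd_mult_iff prime_nat_int_transfer)
  moreover have "[n ^ (p - 1) = int k ^ (p - 1)] (mod int p)"
    by (intro cong_pow) (simp add: k cong_def)
  ultimately show ?thesis using cong_trans by blast
qed

text \<open>Telescoping \<open>(x + 1)^(j + 1) - x^(j + 1)\<close> expresses \<open>(j + 1)\<close>
  times the power sum by \<open>p^(j + 1)\<close> and lower power sums, and \<open>j + 1 < p\<close>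
  is a unit modulo \<open>p\<close>.\<close>

lemma prime_dvd_sum_powers:
  assumes p: "prime p" and j: "j < p - 1"
  shows "int p dvd (\<Sum>x<p. int x ^ j)"
  using j
proof (induction j rule: less_induct)
  case (less j)
  let ?S = "\<lambda>i. \<Sum>x<p. int x ^ i"
  have "int p ^ Suc j = (\<Sum>x<p. int (Suc x) ^ Suc j - int x ^ Suc j)"
    by (subst sum_lessThan_telescope) simp
  also have "\<dots> = (\<Sum>x<p. \<Sum>i\<le>j. of_nat (Suc j choose i) * int x ^ i)"
  proof (rule sum.cong)
    fix x
    have "int (Suc x) ^ Suc j = (\<Sum>i\<le>Suc j. of_nat (Suc j choose i) * int x ^ i)"
      using binomial_ring[of "int x" 1 "Suc j"] by (simp add: add.commute)
    then show "int (Suc x) ^ Suc j - int x ^ Suc j = (\<Sum>i\<le>j. of_nat (Suc j choose i) * int x ^ i)"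
      by simp
  qed simp
  also have "\<dots> = (\<Sum>i\<le>j. of_nat (Suc j choose i) * ?S i)"
    by (subst sum.swap) (simp add: sum_distrib_left)
  also have "\<dots> = (\<Sum>i<j. of_nat (Suc j choose i) * ?S i) + int (Suc j) * ?S j"
    by (simp add: lessThan_Suc_atMost[symmetric])
  finally have "int (Suc j) * ?S j = int p ^ Suc j - (\<Sum>i<j. of_nat (Suc j choose i) * ?S i)"
    by simp
  moreover have "int p dvd (\<Sum>i<j. of_nat (Suc j choose i) * ?S i)"
    using less.IH less.prems by (intro dvd_sum dvd_mult less.IH) auto
  ultimately have "int p dvd int (Suc j) * ?S j" by simp
  moreover have "\<not> int p dvd int (Suc j)" using less.prems by (auto dest!: zdvd_imp_le)
  ultimately show ?case using p prime_dvd_mult_iff[of "int p"] prime_nat_int_transfer by blast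
qed

text \<open>The exponent \<open>p - 1\<close>, whose power sum is not divisible by \<open>p\<close>,
  occurs for \<open>k = p\<close> and is killed by the factor \<open>k\<close>. For
  \<open>k > p\<close> Fermat lowers the exponent to \<open>k - p\<close>, which the bound on
  \<open>k\<close> keeps below \<open>p - 1\<close>. At \<open>k = 2 * p - 1\<close> the claim would
  fail.\<close>

lemma prime_dvd_sum_deriv_powers:
  assumes p: "prime p" and k: "k < 2 * p - 1"
  shows "int p dvd int k * (\<Sum>x<p. int x ^ (k - 1))"
proof -
  consider "k = 0 \<or> k = p" | "0 < k" "k < p" | "p < k" by linarith
  then show ?thesis
  proof cases
    case 2
    then show ?thesis using prime_dvd_sum_powers[OF p, of "k - 1"] by (simp add: dvd_mult)
  next
    case 3
    have p2: "p \<ge> 2" using p prime_ge_2_nat by blast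
    have "[(\<Sum>x<p. int x ^ (k - 1)) = (\<Sum>x<p. int x ^ (k - p))] (mod int p)"
    proof (rule cong_sum)
      fix x assume "x \<in> {..<p}"
      then have x: "x < p" by simp
      have "k - 1 = (p - 1) + (k - p)" using 3 p2 by simp
      then have eq: "int x ^ (k - 1) = int x ^ (p - 1) * int x ^ (k - p)" by (simp add: power_add)
      show "[int x ^ (k - 1) = int x ^ (k - p)] (mod int p)"
      proof (cases "x = 0")
        case False
        then have "\<not> int p dvd int x" using x by (auto dest!: zdvd_imp_le)
        from cong_mult[OF int_fermat[OF p this] cong_refl[of "int x ^ (k - p)"]] show ?thesis
          unfolding eq by simp
      qed (use 3 p2 in \<open>simp add: zero_power\<close>)
    qed
    moreover have "int p dvd (\<Sum>x<p. int x ^ (k - p))"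
      using 3 k by (intro prime_dvd_sum_powers[OF p]) auto
    ultimately have "int p dvd (\<Sum>x<p. int x ^ (k - 1))" using cong_dvd_iff by blast
    then show ?thesis by (rule dvd_mult)
  qed auto
qed

text \<open>The quotient by \<open>p\<close> is explicit because \<open>p\<close> may be a unit of \<open>'a\<close>, as it is in the power
  series over the rationals.\<close>

lemma sum_poly_pderiv:
  fixes G :: "'a :: idom poly"
  assumes p: "prime p" and G: "degree G < 2 * p - 1"
  shows "(\<Sum>x<p. poly (pderiv G) (of_nat x)) =
    of_nat p * (\<Sum>k<2 * p - 1. of_int (int k * (\<Sum>x<p. int x ^ (k - 1)) div int p) * coeff G k)"
proof -
  have pd: "poly (pderiv G) y = (\<Sum>k<2 * p - 1. of_nat k * coeff G k * y ^ (k - 1))" for y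
  proof -
    have "G = (\<Sum>k\<le>2 * p - 2. monom (coeff G k) k)"
      by (rule poly_as_sum_of_monoms'[symmetric]) (use G in linarith)
    also have "{..2 * p - 2} = {..<2 * p - 1}" using G by auto
    finally have "pderiv G = pderiv (\<Sum>k<2 * p - 1. monom (coeff G k) k)" by simp
    moreover have "pderiv (sum g A) = (\<Sum>k\<in>A. pderiv (g k))" for g :: "nat \<Rightarrow> 'a poly" and A
      by (induction A rule: infinite_finite_induct) (auto simp: pderiv_add)
    ultimately show ?thesis
      by (simp add: pderiv_monom poly_sum poly_monom)
  qed
  have "(\<Sum>x<p. poly (pderiv G) (of_nat x)) =
      (\<Sum>k<2 * p - 1. of_nat k * coeff G k * (\<Sum>x<p. of_nat x ^ (k - 1)))"
    unfolding pd by (subst sum.swap) (simp add: sum_distrib_left)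
  also have "\<dots> = (\<Sum>k<2 * p - 1. of_int (int k * (\<Sum>x<p. int x ^ (k - 1))) * coeff G k)"
    by (simp add: mult_ac)
  also have "\<dots> = (\<Sum>k<2 * p - 1. of_int (int p * (int k * (\<Sum>x<p. int x ^ (k - 1)) div int p)) * coeff G k)"
    using prime_dvd_sum_deriv_powers[OF p] by (intro sum.cong) (auto simp del: of_int_mult)
  also have "\<dots> = of_nat p * (\<Sum>k<2 * p - 1. of_int (int k * (\<Sum>x<p. int x ^ (k - 1)) div int p) * coeff G k)"
    by (simp add: sum_distrib_left mult.assoc)
  finally show ?thesis .
qed

section \<open>Integrality and divisibility by \<open>p\<close> for rationals and power
  series\<close>

definition p_divides :: "nat \<Rightarrow> rat \<Rightarrow> bool" where
  "p_divides p x \<longleftrightarrow> p_integral p (x / of_nat p)"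

definition fps_integral :: "nat \<Rightarrow> rat fps \<Rightarrow> bool" where
  "fps_integral p f \<longleftrightarrow> (\<forall>n. p_integral p (f $ n))"

text \<open>Vanishing modulo \<open>p\<close> and \<open>q^p\<close>. The truncation is forced:
  \<open>theta\<close> multiplies the \<open>p\<close>-th coefficient by \<open>p\<close>, so a
  differential equation modulo \<open>p\<close> says nothing about it.\<close>

definition fps_null :: "nat \<Rightarrow> rat fps \<Rightarrow> bool" where
  "fps_null p f \<longleftrightarrow> (\<forall>n<p. p_divides p (f $ n))"

definition poly_integral :: "nat \<Rightarrow> rat fps poly \<Rightarrow> bool" where
  "poly_integral p G \<longleftrightarrow> (\<forall>k. fps_integral p (coeff G k))"

context
  fixes p :: nat
  assumes p: "prime p"
begin

lemma p_integral_0 [simp]: "p_integral p 0" and p_integral_1 [simp]: "p_integral p 1"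
  using p_integral_of_int[OF p, of 0] p_integral_of_int[OF p, of 1] by auto

lemma p_integral_of_nat [simp]: "p_integral p (of_nat n)"
  using p_integral_of_int[OF p, of "int n"] by simp

lemma p_integral_sum: "(\<And>i. i \<in> A \<Longrightarrow> p_integral p (f i)) \<Longrightarrow> p_integral p (sum f A)"
  by (induction A rule: infinite_finite_induct) (auto intro: p_integral_add[OF p])

lemma p_divides_integral: "p_divides p x \<Longrightarrow> p_integral p x"
  using p_integral_mult[OF p p_integral_of_nat[of p], of "x / of_nat p"] prime_gt_0_nat[OF p]
  by (simp add: p_divides_def)

lemma p_divides_0 [simp]: "p_divides p 0"
  by (simp add: p_divides_def)

lemma p_divides_add: "p_divides p x \<Longrightarrow> p_divides p y \<Longrightarrow> p_divides p (x + y)"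
  unfolding p_divides_def add_divide_distrib by (rule p_integral_add[OF p])

lemma p_divides_diff: "p_divides p x \<Longrightarrow> p_divides p y \<Longrightarrow> p_divides p (x - y)"
  unfolding p_divides_def diff_divide_distrib by (rule p_integral_diff[OF p])

lemma p_divides_mult: "p_divides p x \<Longrightarrow> p_integral p y \<Longrightarrow> p_divides p (x * y)"
  using p_integral_mult[OF p, of "x / of_nat p" y] by (simp add: p_divides_def)

lemma p_divides_sum: "(\<And>i. i \<in> A \<Longrightarrow> p_divides p (f i)) \<Longrightarrow> p_divides p (sum f A)"
  by (induction A rule: infinite_finite_induct) (auto intro: p_divides_add)

lemma p_divides_of_nat_mult: "p_integral p x \<Longrightarrow> p_divides p (of_nat p * x)"
  using prime_gt_0_nat[OF p] by (simp add: p_divides_def)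

lemma p_divides_of_int: "int p dvd n \<Longrightarrow> p_divides p (of_int n)"
  using p_integral_of_int[OF p] p_divides_of_nat_mult by (auto elim!: dvdE)

lemma p_divides_cancel:
  assumes "\<not> int p dvd n" "p_divides p (of_int n * x)"
  shows "p_divides p x"
  using assms p_integral_divide_unit[OF p, of n "x / of_nat p"] by (simp add: p_divides_def)

lemma rat_cong_iff_divides:
  "rat_cong p x y \<longleftrightarrow> p_integral p x \<and> p_integral p y \<and> p_divides p (x - y)"
  using rat_cong_iff[OF p] by (auto simp: p_divides_def rat_cong_def)

lemma rat_cong_integral: "rat_cong p x y \<Longrightarrow> p_integral p x"
  by (simp add: rat_cong_def)

lemma rat_cong_refl: "p_integral p x \<Longrightarrow> rat_cong p x x"
  by (simp add: rat_cong_iff_divides)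

lemma rat_cong_sym: "rat_cong p x y \<Longrightarrow> rat_cong p y x"
  unfolding rat_cong_iff_divides using p_divides_diff[of 0 "x - y"] by simp

lemma rat_cong_trans: "rat_cong p x y \<Longrightarrow> rat_cong p y z \<Longrightarrow> rat_cong p x z"
  unfolding rat_cong_iff_divides using p_divides_add[of "x - y" "y - z"] by simp

lemma rat_cong_add: "rat_cong p x y \<Longrightarrow> rat_cong p u v \<Longrightarrow> rat_cong p (x + u) (y + v)"
  unfolding rat_cong_iff_divides using p_divides_add[of "x - y" "u - v"]
  by (simp add: p_integral_add[OF p] algebra_simps)

lemma rat_cong_diff: "rat_cong p x y \<Longrightarrow> rat_cong p u v \<Longrightarrow> rat_cong p (x - u) (y - v)"
  unfolding rat_cong_iff_divides using p_divides_diff[of "x - y" "u - v"]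
  by (simp add: p_integral_diff[OF p] algebra_simps)

lemma rat_cong_mult: "rat_cong p x y \<Longrightarrow> rat_cong p u v \<Longrightarrow> rat_cong p (x * u) (y * v)"
  unfolding rat_cong_iff_divides
  using p_divides_add[OF p_divides_mult[of "x - y" u] p_divides_mult[of "u - v" y]]
  by (simp add: p_integral_mult[OF p] algebra_simps)

lemma rat_cong_power: "rat_cong p x y \<Longrightarrow> rat_cong p (x ^ n) (y ^ n)"
  by (induction n) (auto intro: rat_cong_mult rat_cong_refl)

lemma rat_cong_sum: "(\<And>i. i \<in> A \<Longrightarrow> rat_cong p (f i) (g i)) \<Longrightarrow> rat_cong p (sum f A) (sum g A)"
  by (induction A rule: infinite_finite_induct) (auto intro: rat_cong_add rat_cong_refl)

lemma rat_cong_of_int_iff: "rat_cong p (of_int a) (of_int b) \<longleftrightarrow> [a = b] (mod int p)"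
  using rat_cong_of_int[OF p, of a b] p_divides_of_int[of "a - b"] p_integral_of_int[OF p]
  by (auto simp: rat_cong_iff_divides cong_iff_dvd_diff)

lemma
  shows fps_integral_0: "fps_integral p 0"
    and fps_integral_1: "fps_integral p 1"
    and fps_integral_X: "fps_integral p fps_X"
    and fps_integral_const: "p_integral p c \<Longrightarrow> fps_integral p (fps_const c)"
    and fps_integral_add: "fps_integral p f \<Longrightarrow> fps_integral p g \<Longrightarrow> fps_integral p (f + g)"
    and fps_integral_diff: "fps_integral p f \<Longrightarrow> fps_integral p g \<Longrightarrow> fps_integral p (f - g)"
    and fps_integral_uminus: "fps_integral p f \<Longrightarrow> fps_integral p (- f)"
    and fps_integral_mult: "fps_integral p f \<Longrightarrow> fps_integral p g \<Longrightarrow> fps_integral p (f * g)"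
  by (auto simp: fps_integral_def fps_mult_nth fps_X_def intro!: p_integral_sum p_integral_rules[OF p])

lemma fps_integral_power: "fps_integral p f \<Longrightarrow> fps_integral p (f ^ n)"
  by (induction n) (auto intro: fps_integral_1 fps_integral_mult)

lemma fps_integral_of_int: "fps_integral p (of_int n)"
  unfolding fps_of_int[symmetric] by (intro fps_integral_const p_integral_of_int[OF p])

lemma fps_integral_numeral: "fps_integral p (numeral n)"
  using fps_integral_of_int[of "numeral n"] by simp

lemma fps_integral_of_nat: "fps_integral p (of_nat n)"
  using fps_integral_of_int[of "int n"] by simp

lemma fps_integral_sum: "(\<And>i. i \<in> A \<Longrightarrow> fps_integral p (f i)) \<Longrightarrow> fps_integral p (sum f A)"
  by (induction A rule: infinite_finite_induct) (auto intro: fps_integral_0 fps_integral_add)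

lemma fps_integral_theta: "fps_integral p f \<Longrightarrow> fps_integral p (theta f)"
  unfolding fps_integral_def theta_nth by (auto intro: p_integral_mult[OF p])

lemma fps_integral_inverse:
  assumes f: "fps_integral p f" "f $ 0 = 1"
  shows "fps_integral p (inverse f)"
  unfolding fps_integral_def
proof
  fix n show "p_integral p (inverse f $ n)"
  proof (induction n rule: less_induct)
    case (less n)
    have "(\<Sum>i = 0..n. f $ i * inverse f $ (n - i)) = (1 :: rat fps) $ n"
      using f(2) by (simp add: inverse_mult_eq_1' flip: fps_mult_nth)
    then have "inverse f $ n = (if n = 0 then 1 else 0) - (\<Sum>i = 1..n. f $ i * inverse f $ (n - i))"
      using f(2) by (subst (asm) sum.atLeast_Suc_atMost) auto
    also have "p_integral p \<dots>" using f(1) less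
      by (intro p_integral_diff[OF p] p_integral_sum p_integral_mult[OF p]) (auto simp: fps_integral_def)
    finally show ?case .
  qed
qed

lemmas fps_integral_intros = fps_integral_0 fps_integral_1 fps_integral_X fps_integral_add fps_integral_diff
  fps_integral_uminus fps_integral_mult fps_integral_power fps_integral_of_int fps_integral_numeral
  fps_integral_of_nat fps_integral_sum fps_integral_theta

lemma fps_null_add: "fps_null p f \<Longrightarrow> fps_null p g \<Longrightarrow> fps_null p (f + g)"
  by (auto simp: fps_null_def intro: p_divides_add)

lemma fps_null_diff: "fps_null p f \<Longrightarrow> fps_null p g \<Longrightarrow> fps_null p (f - g)"
  by (auto simp: fps_null_def intro: p_divides_diff)

lemma fps_null_sum: "(\<And>i. i \<in> A \<Longrightarrow> fps_null p (f i)) \<Longrightarrow> fps_null p (sum f A)"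
  by (auto simp: fps_null_def fps_sum_nth intro: p_divides_sum)

lemma fps_null_mult: "fps_null p f \<Longrightarrow> fps_integral p g \<Longrightarrow> fps_null p (f * g)"
  by (auto simp: fps_null_def fps_integral_def fps_mult_nth intro!: p_divides_sum p_divides_mult)

lemma fps_null_of_nat_mult: "fps_integral p f \<Longrightarrow> fps_null p (of_nat p * f)"
  unfolding fps_null_def fps_integral_def
  by (simp add: p_divides_of_nat_mult flip: fps_of_nat)

text \<open>Write \<open>f = 1 + g\<close>. The inner binomial coefficients are divisible by
  \<open>p\<close>, and \<open>g ^ p\<close> starts no earlier than \<open>q^p\<close>.\<close>

lemma fps_null_power_p:
  assumes f: "fps_integral p f" "f $ 0 = 1"
  shows "fps_null p (f ^ p - 1)"
proof -
  define g where "g = f - 1"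
  have g: "fps_integral p g" "g $ 0 = 0"
    using f by (auto simp: g_def intro: fps_integral_intros)
  have p0: "p > 0" using p prime_gt_0_nat by blast
  have "f ^ p = (g + 1) ^ p" by (simp add: g_def)
  also have "\<dots> = (\<Sum>k\<le>p. of_nat (p choose k) * g ^ k)" by (subst binomial_ring) simp
  also have "{..p} = insert 0 (insert p {0<..<p})" using p0 by auto
  also have "(\<Sum>k\<in>\<dots>. of_nat (p choose k) * g ^ k) = 1 + (g ^ p + (\<Sum>k\<in>{0<..<p}. of_nat (p choose k) * g ^ k))"
    using p0 by simp
  finally have "f ^ p - 1 = g ^ p + (\<Sum>k\<in>{0<..<p}. of_nat (p choose k) * g ^ k)" by simp
  moreover have "fps_null p (g ^ p)"
    using startsby_zero_power_prefix[OF g(2), of p] by (simp add: fps_null_def)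
  moreover have "fps_null p (of_nat (p choose k) * g ^ k)" if "k \<in> {0<..<p}" for k
  proof -
    have "p dvd (p choose k)" using that p by (intro dvd_choose_prime) auto
    then obtain c where "p choose k = p * c" ..
    then show ?thesis
      using fps_null_of_nat_mult[of "of_nat c * g ^ k"] g
      by (simp add: mult.assoc fps_integral_intros)
  qed
  ultimately show ?thesis by (simp only:) (intro fps_null_add fps_null_sum)
qed

lemma poly_integral_mult: "poly_integral p G \<Longrightarrow> poly_integral p H \<Longrightarrow> poly_integral p (G * H)"
  by (auto simp: poly_integral_def coeff_mult intro!: fps_integral_intros)

lemma poly_integral_power: "poly_integral p G \<Longrightarrow> poly_integral p (G ^ n)"
proof (induction n)
  case 0
  show ?case by (auto simp: poly_integral_def coeff_1 fps_integral_0 fps_integral_1)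
qed (simp add: poly_integral_mult)

lemma poly_integral_pCons: "fps_integral p c \<Longrightarrow> poly_integral p G \<Longrightarrow> poly_integral p (pCons c G)"
  by (auto simp: poly_integral_def coeff_pCons split: nat.splits)

lemma poly_integral_0: "poly_integral p 0"
  by (simp add: poly_integral_def fps_integral_0)

lemma poly_integral_poly: "poly_integral p G \<Longrightarrow> fps_integral p x \<Longrightarrow> fps_integral p (poly G x)"
  by (auto simp: poly_integral_def poly_altdef intro!: fps_integral_intros)

end

section \<open>The Picard--Fuchs equation\<close>

text \<open>Both \<open>kappa\<close> and \<open>mu\<close> have weight 2, with
  \<open>E4 = kappa * mu\<close> and \<open>E6 = kappa^2 * mu\<close>. In terms of
  \<open>E2\<close>, \<open>kappa\<close> and \<open>mu\<close> Ramanujan's equations have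
  polynomial right-hand sides.\<close>

definition kappa :: "rat fps" where
  "kappa = E6 * inverse E4"

definition mu :: "rat fps" where
  "mu = E4 ^ 2 * inverse E6"

lemma E4_nth_0 [simp]: "E4 $ 0 = 1" and E6_nth_0 [simp]: "E6 $ 0 = 1"
  by (simp_all add: E4_def E6_def)

lemma kappa_mult_E4: "kappa * E4 = E6"
  using inverse_mult_eq_1[of E4] by (simp add: kappa_def mult.assoc)

lemma mu_mult_E6: "mu * E6 = E4 ^ 2"
  using inverse_mult_eq_1[of E6] by (simp add: mu_def mult.assoc)

lemma E4_nonzero: "E4 \<noteq> 0" and E6_nonzero: "E6 \<noteq> 0"
  using E4_nth_0 E6_nth_0 by (metis fps_zero_nth zero_neq_one)+

lemma kappa_mult_mu: "kappa * mu = E4"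
proof -
  have "kappa * mu * E4 = mu * (kappa * E4)" by simp
  also have "\<dots> = E4 * E4" unfolding kappa_mult_E4 by (simp add: mu_mult_E6 power2_eq_square)
  finally show ?thesis using E4_nonzero by simp
qed

lemma theta_add: "theta (f + g) = theta f + theta g"
  and theta_diff: "theta (f - g) = theta f - theta g"
  and theta_mult: "theta (f * g) = theta f * g + f * theta g"
  and theta_power: "theta (f ^ n) = of_nat n * f ^ (n - 1) * theta f"
  and theta_numeral: "theta (numeral k) = 0"
  and theta_of_nat: "theta (of_nat n) = 0"
  by (simp_all add: theta_def fps_deriv_power' algebra_simps numeral_fps_const flip: fps_of_nat)

text \<open>The logarithmic derivative of \<open>kappa\<close> is that of \<open>E6\<close> minus
  that of \<open>E4\<close>; multiplying by \<open>E4\<close> avoids quotients.\<close>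

lemma theta_kappa: "6 * theta kappa = kappa * (E2 - 3 * mu + 2 * kappa)"
proof -
  note z = right_minus_eq[THEN iffD2]
  have "theta kappa * E4 + kappa * theta E4 = theta E6"
    using theta_mult[of kappa E4] unfolding kappa_mult_E4 by simp
  from this[THEN z] have "(6 * theta kappa) * E4 = kappa * (E2 - 3 * mu + 2 * kappa) * E4"
    using ramanujan[THEN z] kappa_mult_E4[THEN z] kappa_mult_mu[THEN z] by algebra
  then show ?thesis using E4_nonzero by simp
qed

lemma theta_mu: "6 * theta mu = mu * (E2 - 4 * kappa + 3 * mu)"
proof -
  note z = right_minus_eq[THEN iffD2]
  have "theta mu * E6 + mu * theta E6 = 2 * E4 * theta E4"
    using theta_mult[of mu E6] theta_power[of E4 2] unfolding mu_mult_E6 by simp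
  from this[THEN z] have "(6 * theta mu) * E6 = mu * (E2 - 4 * kappa + 3 * mu) * E6"
    using ramanujan[THEN z] kappa_mult_E4[THEN z] kappa_mult_mu[THEN z] mu_mult_E6[THEN z] by algebra
  then show ?thesis using E6_nonzero by simp
qed

lemma theta_E2: "12 * theta E2 = E2 ^ 2 - kappa * mu"
  using ramanujan(1) by (simp add: kappa_mult_mu)

text \<open>The coefficients come from the linear system which expresses that \<open>72 \<theta>\<^sup>2 (P\<^sup>r)\<close> is the
  derivative of \<open>P\<^sup>r\<^sup>-\<^sup>1 cert\<close> with respect to \<open>t\<close>, for \<open>P = \<kappa> t\<^sup>3 - 27 \<mu> (t + 2)\<close> and \<open>r = - 1/2\<close>,
  the residue of \<open>(p - 1)/2\<close> modulo \<open>p\<close>.\<close>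

definition cert :: "rat fps poly" where
  "cert = [:972 * mu ^ 3 - 972 * kappa * mu ^ 2,
    972 * mu ^ 3 - 108 * kappa * mu ^ 2 - 864 * kappa ^ 2 * mu,
    243 * mu ^ 3 + 297 * kappa * mu ^ 2 - 540 * kappa ^ 2 * mu, 0,
    - 27 * kappa * mu ^ 2 + 23 * kappa ^ 2 * mu + 4 * kappa ^ 3:]"

definition cubic :: "rat fps poly" where
  "cubic = [:- 54 * mu, - 27 * mu, 0, kappa:]"

text \<open>This and \<open>cubic_theta2\<close> are \<open>6 * theta P\<close> and
  \<open>72 * theta (theta P)\<close> for \<open>P = poly cubic t\<close> with \<open>t\<close>
  constant, written out so that the certificate becomes a polynomial identity in \<open>E2\<close>,
  \<open>kappa\<close>, \<open>mu\<close> and \<open>t\<close>.\<close>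

definition cubic_theta1 :: "rat fps \<Rightarrow> rat fps" where
  "cubic_theta1 t = kappa * (E2 - 3 * mu + 2 * kappa) * t ^ 3
     - 27 * (mu * (E2 - 4 * kappa + 3 * mu)) * (t + 2)"

definition cubic_theta2 :: "rat fps \<Rightarrow> rat fps" where
  "cubic_theta2 t =
    (2 * kappa * (E2 - 3 * mu + 2 * kappa) ^ 2 + kappa * (E2 ^ 2 - kappa * mu
       - 6 * (mu * (E2 - 4 * kappa + 3 * mu)) + 4 * (kappa * (E2 - 3 * mu + 2 * kappa)))) * t ^ 3
    - 27 * (2 * mu * (E2 - 4 * kappa + 3 * mu) ^ 2 + mu * (E2 ^ 2 - kappa * mu
       - 8 * (kappa * (E2 - 3 * mu + 2 * kappa)) + 6 * (mu * (E2 - 4 * kappa + 3 * mu)))) * (t + 2)"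

lemma poly_cubic: "poly cubic t = kappa * t ^ 3 - 27 * mu * (t + 2)"
  unfolding cubic_def by (simp add: algebra_simps power_numeral_reduce)

lemma poly_pderiv_cubic: "poly (pderiv cubic) t = 3 * kappa * t ^ 2 - 27 * mu"
  unfolding cubic_def by (simp add: pderiv_pCons algebra_simps power_numeral_reduce)

text \<open>Let \<open>P\<close>, \<open>Q1\<close>, \<open>Q2\<close>, \<open>V\<close> stand for
  the cubic, \<open>cubic_theta1\<close>, \<open>cubic_theta2\<close> and \<open>cert\<close>.
  Equating \<open>72 * theta (theta (P^r))\<close> with the \<open>t\<close>-derivative of
  \<open>P^(r-1) V\<close> gives \<open>r (2 (r - 1) Q1^2 + P Q2) = (r - 1) P' V + P V'\<close>; the
  identity is twice this at \<open>r = - 1/2\<close>. There \<open>P^r\<close> has weight -1, which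
  \<open>theta\<close> applied twice takes to weight 3 by Bol's identity. This is why
  \<open>E2\<close> cancels and \<open>cert\<close> is free of it.\<close>

lemma cert_identity:
  "3 * cubic_theta1 t ^ 2 - poly cubic t * cubic_theta2 t
     + 3 * poly (pderiv cubic) t * poly cert t - 2 * poly cubic t * poly (pderiv cert) t = 0"
proof -
  have c: "poly cert t = 972 * mu ^ 3 - 972 * kappa * mu ^ 2
    + (972 * mu ^ 3 - 108 * kappa * mu ^ 2 - 864 * kappa ^ 2 * mu) * t
    + (243 * mu ^ 3 + 297 * kappa * mu ^ 2 - 540 * kappa ^ 2 * mu) * t ^ 2
    + (- 27 * kappa * mu ^ 2 + 23 * kappa ^ 2 * mu + 4 * kappa ^ 3) * t ^ 4"
    unfolding cert_def by (simp add: algebra_simps power_numeral_reduce)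
  have c': "poly (pderiv cert) t = 972 * mu ^ 3 - 108 * kappa * mu ^ 2 - 864 * kappa ^ 2 * mu
    + 2 * (243 * mu ^ 3 + 297 * kappa * mu ^ 2 - 540 * kappa ^ 2 * mu) * t
    + 4 * (- 27 * kappa * mu ^ 2 + 23 * kappa ^ 2 * mu + 4 * kappa ^ 3) * t ^ 3"
    unfolding cert_def by (simp add: pderiv_pCons algebra_simps power_numeral_reduce)
  show ?thesis
    unfolding c c' poly_cubic poly_pderiv_cubic cubic_theta1_def cubic_theta2_def
    by algebra
qed

lemma theta_cubic:
  assumes t: "theta t = 0"
  shows "6 * theta (poly cubic t) = cubic_theta1 t"
    and "12 * theta (cubic_theta1 t) = cubic_theta2 t"
proof -
  note z = right_minus_eq[THEN iffD2]
  note T = theta_add theta_diff theta_mult theta_numeral theta_power t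
  show "6 * theta (poly cubic t) = cubic_theta1 t"
    unfolding poly_cubic cubic_theta1_def T
    using theta_kappa[THEN z] theta_mu[THEN z] by algebra
  show "12 * theta (cubic_theta1 t) = cubic_theta2 t"
    unfolding cubic_theta1_def cubic_theta2_def T
    using theta_kappa[THEN z] theta_mu[THEN z] theta_E2[THEN z] by algebra
qed

text \<open>The exponent \<open>n + 2\<close> exceeds \<open>- 1/2\<close> by
  \<open>(2 * n + 5) / 2\<close>. Hence second derivative and exact term differ by a multiple of
  \<open>2 * n + 5\<close>, which becomes \<open>p\<close> when
  \<open>n + 2 = (p - 1) div 2\<close>.\<close>

lemma theta_theta_cubic_power:
  assumes t: "theta t = 0"
  shows "144 * theta (theta (poly cubic t ^ (n + 2))) =
    2 * poly (pderiv (cubic ^ (n + 1) * cert)) t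
    + of_nat (2 * n + 5) * (poly cubic t ^ n * (of_nat (2 * n + 1) * cubic_theta1 t ^ 2
        + poly cubic t * cubic_theta2 t - poly (pderiv cubic) t * poly cert t))"
proof -
  let ?P = "poly cubic t"
  note T = theta_mult theta_numeral theta_of_nat
  have "6 * theta (?P ^ (n + 2)) = of_nat (n + 2) * (?P ^ (n + 1) * cubic_theta1 t)"
    unfolding theta_power theta_cubic(1)[OF t, symmetric] by simp
  then have "theta (6 * theta (?P ^ (n + 2))) = theta (of_nat (n + 2) * (?P ^ (n + 1) * cubic_theta1 t))"
    by simp
  then have 0: "6 * theta (theta (?P ^ (n + 2))) =
      of_nat (n + 2) * (theta (?P ^ (n + 1)) * cubic_theta1 t + ?P ^ (n + 1) * theta (cubic_theta1 t))"
    unfolding T by simp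
  have "144 * theta (theta (?P ^ (n + 2))) = 24 * (6 * theta (theta (?P ^ (n + 2))))"
    by simp
  also have "\<dots> = 2 * of_nat (n + 2) *
      (12 * theta (?P ^ (n + 1)) * cubic_theta1 t + ?P ^ (n + 1) * (12 * theta (cubic_theta1 t)))"
    unfolding 0 by (simp add: algebra_simps)
  finally have "144 * theta (theta (?P ^ (n + 2))) = 2 * of_nat (n + 2) *
      (12 * theta (?P ^ (n + 1)) * cubic_theta1 t + ?P ^ (n + 1) * (12 * theta (cubic_theta1 t)))" .
  moreover have "12 * theta (?P ^ (n + 1)) = 2 * of_nat (n + 1) * ?P ^ n * cubic_theta1 t"
    unfolding theta_power theta_cubic(1)[OF t, symmetric] by simp
  ultimately have 1: "144 * theta (theta (?P ^ (n + 2))) = 2 * of_nat (n + 2) *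
      (2 * of_nat (n + 1) * ?P ^ n * cubic_theta1 t * cubic_theta1 t + ?P ^ (n + 1) * cubic_theta2 t)"
    unfolding theta_cubic(2)[OF t] by simp
  have 2: "poly (pderiv (cubic ^ (n + 1) * cert)) t =
      of_nat (n + 1) * ?P ^ n * poly (pderiv cubic) t * poly cert t + ?P ^ (n + 1) * poly (pderiv cert) t"
    unfolding pderiv_mult pderiv_power by (simp add: algebra_simps)
  have ring: "2 * (N + 2) * (2 * (N + 1) * R * Q1 * Q1 + R * P * Q2) =
      2 * ((N + 1) * R * D * V + R * P * V') + (2 * N + 5) * (R * ((2 * N + 1) * Q1\<^sup>2 + P * Q2 - D * V))"
    if "3 * Q1\<^sup>2 - P * Q2 + 3 * D * V - 2 * P * V' = 0" for N P R Q1 Q2 D V V' :: "rat fps"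
    using that by algebra
  show ?thesis
    unfolding 1 2
    unfolding of_nat_add of_nat_mult of_nat_numeral of_nat_1 power_add power_one_right
    using cert_identity by (rule ring)
qed

section \<open>The series of \<open>1 / j\<close>\<close>

lemma kappa_nth_0 [simp]: "kappa $ 0 = 1" and mu_nth_0 [simp]: "mu $ 0 = 1"
  by (simp_all add: kappa_def mu_def power2_eq_square)

definition ratio :: "rat fps" where
  "ratio = kappa * inverse mu"

definition j_inv :: "rat fps" where
  "j_inv = fps_const (1 / 1728) * (1 - ratio)"

lemma mu_nonzero: "mu \<noteq> 0"
  using mu_nth_0 by (metis fps_zero_nth zero_neq_one)

lemma mu_mult_ratio: "mu * ratio = kappa"
  using inverse_mult_eq_1'[of mu] by (simp add: ratio_def mult.left_commute)

lemma ratio_eq: "ratio = 1 - 1728 * j_inv"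
  by (simp add: j_inv_def numeral_fps_const flip: mult.assoc)

text \<open>The logarithmic derivatives of \<open>kappa\<close> and \<open>mu\<close> differ by
  \<open>kappa - mu\<close>, without \<open>E2\<close>, and
  \<open>mu * ratio = kappa\<close>.\<close>

lemma theta_ratio: "theta ratio = kappa * (ratio - 1)"
proof -
  note z = right_minus_eq[THEN iffD2]
  have "theta mu * ratio + mu * theta ratio = theta kappa"
    using theta_mult[of mu ratio] by (simp add: mu_mult_ratio)
  from this[THEN z] have "mu * (6 * theta ratio) = mu * (6 * (kappa * (ratio - 1)))"
    using mu_mult_ratio[THEN z] theta_mu[THEN z] theta_kappa[THEN z] by algebra
  then show ?thesis using mu_nonzero by simp
qed

lemma theta_j_inv: "theta j_inv = kappa * j_inv"
proof -
  have "theta ratio = - (1728 * theta j_inv)"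
    unfolding ratio_eq by (simp add: theta_def numeral_fps_const algebra_simps)
  also have "theta ratio = kappa * (- (1728 * j_inv))"
    unfolding theta_ratio by (subst ratio_eq) simp
  finally show ?thesis by simp
qed

lemma j_inv_nth_0 [simp]: "j_inv $ 0 = 0"
  by (simp add: j_inv_def ratio_def)

lemma j_inv_nth_1: "j_inv $ 1 = 1"
proof -
  have e: "E4 $ 1 = 240" "E6 $ 1 = - 504"
    by (simp_all add: E4_def E6_def sigma_sum_def)
  have "kappa $ 1 + 240 = - 504"
    using arg_cong[OF kappa_mult_E4, of "\<lambda>f. f $ 1"] e by (simp add: fps_mult_nth_1)
  moreover have "mu $ 1 - 504 = 480"
    using arg_cong[OF mu_mult_E6, of "\<lambda>f. f $ 1"] e by (simp add: fps_mult_nth_1 power2_eq_square)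
  moreover have "mu $ 1 + ratio $ 1 = kappa $ 1"
    using arg_cong[OF mu_mult_ratio, of "\<lambda>f. f $ 1"] by (simp add: fps_mult_nth_1 ratio_def)
  ultimately show ?thesis by (simp add: j_inv_def)
qed

lemma modular_j_eq: "modular_j = 1 / fps_to_fls j_inv"
proof -
  have "E6 = kappa ^ 2 * mu"
    using kappa_mult_E4 kappa_mult_mu by (simp add: power2_eq_square mult.assoc)
  moreover have "E4 = kappa * mu" by (simp add: kappa_mult_mu)
  moreover note mu_mult_ratio
  ultimately have "E4 ^ 3 * ratio = E6 ^ 2"
    by (metis (no_types, opaque_lifting) mult.assoc mult.commute power2_eq_square power3_eq_cube)
  then have "E4 ^ 3 - E6 ^ 2 = 1728 * E4 ^ 3 * j_inv"
    by (simp add: ratio_eq algebra_simps)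
  then have "modular_j = 1728 * fps_to_fls (E4 ^ 3) / (1728 * fps_to_fls (E4 ^ 3) * fps_to_fls j_inv)"
    unfolding modular_j_def by (simp add: fls_times_fps_to_fls)
  moreover have "fps_to_fls (E4 ^ 3) \<noteq> 0" using E4_nonzero by (simp add: fps_to_fls_eq_0_iff)
  ultimately show ?thesis by simp
qed

text \<open>The quotient is \<open>E4 * j_inv / (1 - c * j_inv)\<close>, a geometric series in
  \<open>c * j_inv\<close>. After \<open>N\<close> terms the remainder contains
  \<open>j_inv ^ Suc N\<close>, hence has no coefficient up to \<open>q^N\<close>.\<close>

lemma E4_div_j_minus_nth:
  "fls_nth (E4_div_j_minus c) (int N) = (\<Sum>n<N. c ^ n * (E4 * j_inv ^ Suc n) $ N)"
proof -
  let ?u = "fps_const c * j_inv"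
  let ?F = "E4 * j_inv * inverse (1 - ?u)"
  have u: "(1 - ?u) $ 0 \<noteq> 0" by simp
  then have nz: "1 - ?u \<noteq> 0" by (metis fps_zero_nth)
  have j: "j_inv \<noteq> 0" using j_inv_nth_1 by (metis fps_zero_nth zero_neq_one)
  have F: "?F * (1 - ?u) = E4 * j_inv"
    using inverse_mult_eq_1[OF u] by (simp add: mult.assoc)
  have "E4_div_j_minus c = fps_to_fls E4 * fps_to_fls j_inv / (1 - fls_const c * fps_to_fls j_inv)"
    unfolding E4_div_j_minus_def modular_j_eq using j
    by (simp add: field_simps fps_to_fls_eq_0_iff)
  also have "1 - fls_const c * fps_to_fls j_inv = fps_to_fls (1 - ?u)"
    by (simp add: fls_times_fps_to_fls)
  also have "fps_to_fls E4 * fps_to_fls j_inv = fps_to_fls ?F * fps_to_fls (1 - ?u)"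
    unfolding fls_times_fps_to_fls[symmetric] F ..
  finally have "E4_div_j_minus c = fps_to_fls ?F"
    using nz by (simp add: fps_to_fls_eq_0_iff del: fps_to_fls_minus)
  then have "fls_nth (E4_div_j_minus c) (int N) = ?F $ N" by simp
  also have "?F = E4 * j_inv * ((\<Sum>n<N. ?u ^ n) + ?u ^ N * inverse (1 - ?u))"
  proof -
    have "(1 - ?u) * (\<Sum>n<N. ?u ^ n) = 1 - ?u ^ N"
      by (rule one_diff_power_eq[symmetric])
    then have "inverse (1 - ?u) = inverse (1 - ?u) * ((1 - ?u) * (\<Sum>n<N. ?u ^ n) + ?u ^ N)"
      by simp
    also have "\<dots> = (\<Sum>n<N. ?u ^ n) + ?u ^ N * inverse (1 - ?u)"
      by (simp add: distrib_left inverse_mult_eq_1[OF u] flip: mult.assoc)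
    finally show ?thesis by (rule arg_cong)
  qed
  also have "\<dots> = (\<Sum>n<N. fps_const (c ^ n) * (E4 * j_inv ^ Suc n)) + j_inv ^ Suc N * (E4 * fps_const (c ^ N) * inverse (1 - ?u))"
    by (simp add: algebra_simps sum_distrib_left power_mult_distrib fps_const_power)
  also have "\<dots> $ N = (\<Sum>n<N. c ^ n * (E4 * j_inv ^ Suc n) $ N)"
  proof -
    have "(j_inv ^ Suc N * g) $ N = 0" for g
      using startsby_zero_power_prefix[OF j_inv_nth_0, of "Suc N"]
      by (simp only: fps_mult_nth) (rule sum.neutral, auto)
    then show ?thesis by (simp only: fps_add_nth fps_sum_nth fps_mult_left_const_nth add_0_right)
  qed
  finally show ?thesis .
qed

text \<open>Modulo \<open>p\<close> this is minus the Frobenius trace of \<open>y\<^sup>2 = w x\<^sup>3 - 27 (x + 2)\<close>, a curve with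
  \<open>j\<close>-invariant \<open>1728 / (1 - w)\<close>.\<close>

definition curve_sum :: "nat \<Rightarrow> 'a :: comm_ring_1 \<Rightarrow> 'a" where
  "curve_sum p w = (\<Sum>x<p. (w * of_nat x ^ 3 - 27 * (of_nat x + 2)) ^ ((p - 1) div 2))"

section \<open>Curve sums over polynomials and power series\<close>

lemma curve_sum_ratio: "mu ^ ((p - 1) div 2) * curve_sum p ratio = (\<Sum>x<p. poly cubic (of_nat x) ^ ((p - 1) div 2))"
proof -
  have "poly cubic t = mu * (ratio * t ^ 3 - 27 * (t + 2))" for t
    unfolding poly_cubic mu_mult_ratio[symmetric] by (simp add: algebra_simps)
  then show ?thesis by (simp add: curve_sum_def sum_distrib_left power_mult_distrib)
qed

lemma poly_curve_sum: "poly (curve_sum p q) u = curve_sum p (poly q u)"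
  by (simp add: curve_sum_def poly_sum)

lemma fps_of_poly_curve_sum: "fps_of_poly (curve_sum p q) = curve_sum p (fps_of_poly q)"
proof -
  have "fps_of_poly (of_nat n) = (of_nat n :: 'a :: comm_ring_1 fps)" for n
    by (induction n) (simp_all add: fps_of_poly_add)
  then show ?thesis
    by (simp add: curve_sum_def fps_of_poly_sum fps_of_poly_power fps_of_poly_diff fps_of_poly_mult fps_of_poly_add)
qed

lemma fps_compose_curve_sum:
  fixes f g :: "'a :: idom fps"
  assumes "g $ 0 = 0"
  shows "curve_sum p f oo g = curve_sum p (f oo g)"
proof -
  have "of_nat n oo g = of_nat n" "numeral k oo g = numeral k" for n k
    by (simp_all add: numeral_fps_const flip: fps_of_nat)
  then show ?thesis
    by (simp add: curve_sum_def fps_compose_sum_distrib fps_compose_power[OF assms, symmetric]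
        fps_compose_sub_distrib fps_compose_add_distrib fps_compose_mult_distrib[OF assms])
qed

text \<open>This makes the square of the curve sum at a linear polynomial have degree at most
  \<open>p - 1\<close>, so that each of its coefficients is picked out by one \<open>p\<close>-th
  coefficient below.\<close>

lemma degree_curve_sum:
  fixes q :: "'a :: comm_ring_1 poly"
  assumes "degree q \<le> 1"
  shows "degree (curve_sum p q) \<le> (p - 1) div 2"
  unfolding curve_sum_def
proof (rule degree_sum_le)
  fix x
  have "degree (of_nat x ^ 3 :: 'a poly) = 0"
    by (simp add: of_nat_poly poly_const_pow)
  then have "degree (q * of_nat x ^ 3) \<le> 1"
    using degree_mult_le[of q "of_nat x ^ 3"] assms by simp
  moreover have "27 * (of_nat x + 2) = ([:27 * (of_nat x + 2):] :: 'a poly)"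
    by (simp add: of_nat_poly numeral_poly)
  ultimately have "degree (q * of_nat x ^ 3 - 27 * (of_nat x + 2)) \<le> 1"
    by (metis degree_diff_le degree_pCons_0 zero_le)
  then have "degree (q * of_nat x ^ 3 - 27 * (of_nat x + 2)) * ((p - 1) div 2) \<le> 1 * ((p - 1) div 2)"
    by (rule mult_le_mono1)
  with degree_power_le show "degree ((q * of_nat x ^ 3 - 27 * (of_nat x + 2)) ^ ((p - 1) div 2)) \<le> (p - 1) div 2"
    by (metis (no_types) le_trans mult_1)
qed simp

lemma fps_of_poly_compose:
  fixes R :: "'a :: idom poly"
  assumes "degree R < N" and g: "g $ 0 = 0"
  shows "fps_of_poly R oo g = (\<Sum>k<N. fps_const (coeff R k) * g ^ k)"
proof -
  obtain N' where N: "N = Suc N'" using assms by (cases N) auto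
  have "R = (\<Sum>k<N. monom (coeff R k) k)"
    using poly_as_sum_of_monoms'[of R N'] assms by (simp add: N lessThan_Suc_atMost)
  then have "fps_of_poly R = (\<Sum>k<N. fps_const (coeff R k) * fps_X ^ k)"
    by (metis (no_types, lifting) fps_of_poly_monom fps_of_poly_sum sum.cong)
  then show ?thesis
    by (simp add: fps_compose_sum_distrib fps_compose_mult_distrib[OF g] g
        fps_compose_power[OF g, symmetric])
qed

section \<open>The Weierstrass invariants \<open>c4\<close> and \<open>c6\<close>\<close>

definition c6 :: "weierstrass \<Rightarrow> rat" where
  "c6 W = - (b2 W ^ 3) + 36 * b2 W * b4 W - 216 * b6 W"

lemma c4_c6_discriminant: "c4 W ^ 3 - c6 W ^ 2 = 1728 * discriminant W"
  unfolding c4_def c6_def discriminant_def b2_def b4_def b6_def b8_def by algebra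

lemma c4_change_of_vars:
  assumes "change_of_vars u r s t W M"
  shows "u ^ 4 * c4 M = c4 W"
proof -
  have e: "u * a1 M = a1 W + 2 * s"
     "u ^ 2 * a2 M = a2 W - s * a1 W + 3 * r - s\<^sup>2"
     "u ^ 3 * a3 M = a3 W + r * a1 W + 2 * t"
     "u ^ 4 * a4 M = a4 W - s * a3 W + 2 * r * a2 W - (t + r * s) * a1 W + 3 * r\<^sup>2 - 2 * s * t"
    using assms unfolding change_of_vars_def by auto
  have "u ^ 2 * b2 M = (u * a1 M)\<^sup>2 + 4 * (u ^ 2 * a2 M)" unfolding b2_def by algebra
  then have b2: "u ^ 2 * b2 M = b2 W + 12 * r" unfolding e unfolding b2_def by algebra
  have "u ^ 4 * b4 M = 2 * (u ^ 4 * a4 M) + (u * a1 M) * (u ^ 3 * a3 M)" unfolding b4_def by algebra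
  then have b4: "u ^ 4 * b4 M = b4 W + r * b2 W + 6 * r ^ 2" unfolding e unfolding b2_def b4_def by algebra
  have "u ^ 4 * c4 M = (u ^ 2 * b2 M) ^ 2 - 24 * (u ^ 4 * b4 M)" unfolding c4_def by algebra
  then show ?thesis unfolding b2 b4 unfolding c4_def by algebra
qed

lemma j_invariant_isomorphic:
  assumes "isomorphic_over_Q W M"
  shows "j_invariant M = j_invariant W"
proof -
  obtain u r s t where c: "change_of_vars u r s t W M"
    using assms unfolding isomorphic_over_Q_def by blast
  have u: "u \<noteq> 0" using c unfolding change_of_vars_def by blast
  have "j_invariant W = (u ^ 4 * c4 M) ^ 3 / (u ^ 12 * discriminant M)"
    unfolding j_invariant_def c4_change_of_vars[OF c] discriminant_change_of_vars[OF c] ..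
  also have "\<dots> = u ^ 12 * c4 M ^ 3 / (u ^ 12 * discriminant M)"
    by (simp add: power_mult_distrib flip: power_mult)
  finally show ?thesis using u by (simp add: j_invariant_def)
qed

section \<open>The curve sum modulo a prime \<open>p \<ge> 5\<close>\<close>

context
  fixes p :: nat
  assumes p: "prime p" "p \<ge> 5"
begin

lemma odd_p: "p = 2 * ((p - 1) div 2) + 1"
proof -
  have "odd p" using prime_odd_nat[OF p(1)] p(2) by simp
  then show ?thesis by simp
qed

lemma not_dvd_small: "\<not> int p dvd 2" "\<not> int p dvd 3"
  using p(2) by (auto dest!: zdvd_imp_le)

lemma not_dvd_product: "\<not> int p dvd a \<Longrightarrow> \<not> int p dvd b \<Longrightarrow> \<not> int p dvd a * b"
  using p(1) by (simp add: prime_dvd_mult_iff)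

lemma not_dvd_power: "\<not> int p dvd a \<Longrightarrow> \<not> int p dvd a ^ n"
  using p(1) by (meson prime_dvd_power prime_nat_int_transfer)

lemmas integral_intros = fps_integral_intros[OF p(1)]

lemma fps_integral_div_series: "fps_integral p (div_series k)"
  by (simp add: fps_integral_def div_series_def p_integral_of_nat[OF p(1)])

lemma fps_integral_Eisenstein: "fps_integral p E2" "fps_integral p E4" "fps_integral p E6"
  unfolding E2_def E4_eq E6_eq by (intro integral_intros fps_integral_div_series)+

lemma fps_integral_kappa: "fps_integral p kappa" and fps_integral_mu: "fps_integral p mu"
  unfolding kappa_def mu_def
  by (intro integral_intros fps_integral_Eisenstein fps_integral_inverse[OF p(1)]; simp)+

lemma fps_integral_ratio: "fps_integral p ratio"
  unfolding ratio_def
  by (intro integral_intros fps_integral_kappa fps_integral_mu fps_integral_inverse[OF p(1)]) simp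

lemma p_integral_inverse_of_int: "\<not> int p dvd n \<Longrightarrow> p_integral p (1 / of_int n)"
  using p_integral_iff[OF p(1)] by (metis of_int_1)

lemma fps_integral_j_inv: "fps_integral p j_inv"
proof -
  have "\<not> int p dvd 2 ^ 6 * 3 ^ 3"
    by (intro not_dvd_product not_dvd_power not_dvd_small)
  then have "p_integral p (1 / of_int (2 ^ 6 * 3 ^ 3))" by (rule p_integral_inverse_of_int)
  then have "p_integral p (1 / 1728)" by simp
  then show ?thesis unfolding j_inv_def
    by (intro integral_intros fps_integral_const[OF p(1)] fps_integral_ratio)
qed

text \<open>Summing the exact identity over all residues \<open>x\<close> turns its derivative term
  into a multiple of \<open>p\<close>, since derivatives of low degree sum to zero modulo
  \<open>p\<close>. So \<open>p\<close> divides \<open>144 * k^2\<close> times the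
  \<open>k\<close>-th coefficient, and \<open>144 * k^2\<close> is a unit for
  \<open>0 < k < p\<close>.\<close>

lemma fps_null_cubic_sum:
  defines "f \<equiv> (\<Sum>x<p. poly cubic (of_nat x) ^ ((p - 1) div 2))"
  shows "fps_null p (f - fps_const (f $ 0))"
proof -
  obtain n where n: "(p - 1) div 2 = n + 2" "p = 2 * n + 5"
  proof
    show "(p - 1) div 2 = (p - 1) div 2 - 2 + 2" using p(2) by simp
    show "p = 2 * ((p - 1) div 2 - 2) + 5" using odd_p p(2) by linarith
  qed
  note I = integral_intros fps_integral_kappa fps_integral_mu fps_integral_Eisenstein
  have cubic: "poly_integral p cubic" and cert: "poly_integral p cert"
    unfolding cubic_def cert_def
    by (intro poly_integral_pCons[OF p(1)] poly_integral_0[OF p(1)] I)+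
  define G where "G = cubic ^ (n + 1) * cert"
  have G: "poly_integral p G"
    unfolding G_def by (intro poly_integral_mult[OF p(1)] poly_integral_power[OF p(1)] cubic cert)
  define H where "H = (\<lambda>t. poly cubic t ^ n * (of_nat (2 * n + 1) * cubic_theta1 t ^ 2
      + poly cubic t * cubic_theta2 t - poly (pderiv cubic) t * poly cert t))"
  have H: "fps_integral p (H (of_nat x))" for x
    unfolding H_def poly_pderiv_cubic cubic_theta1_def cubic_theta2_def
    by (intro I poly_integral_poly[OF p(1)] cubic cert)
  define K where "K = (\<Sum>k<2 * p - 1. of_int (int k * (\<Sum>x<p. int x ^ (k - 1)) div int p) * coeff G k)"
  have K: "fps_integral p K"
    unfolding K_def using G by (intro integral_intros) (simp add: poly_integral_def)
  have "degree cubic \<le> 3" "degree cert \<le> 4"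
    by (simp_all add: cubic_def cert_def)
  then have "degree G \<le> 3 * (n + 1) + 4"
    unfolding G_def using degree_mult_le[of "cubic ^ (n + 1)" cert] degree_power_le[of cubic "n + 1"]
    by (meson add_mono le_trans mult_le_mono1)
  \<comment> \<open>With \<open>p = 2 * n + 5\<close> this reads
    \<open>3 * n + 7 < 4 * n + 9\<close>.\<close>
  then have "degree G < 2 * p - 1" using n(2) by simp
  from sum_poly_pderiv[OF p(1) this] have dG: "(\<Sum>x<p. poly (pderiv G) (of_nat x)) = of_nat p * K"
    unfolding K_def .
  have "theta (sum g A) = (\<Sum>x\<in>A. theta (g x))" for g :: "nat \<Rightarrow> rat fps" and A
    by (simp add: theta_def fps_deriv_sum sum_distrib_left)
  then have "144 * theta (theta f) = (\<Sum>x<p. 144 * theta (theta (poly cubic (of_nat x) ^ (n + 2))))"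
    unfolding f_def n(1) by (simp add: sum_distrib_left)
  also have "\<dots> = (\<Sum>x<p. 2 * poly (pderiv G) (of_nat x) + of_nat p * H (of_nat x))"
    unfolding theta_theta_cubic_power[OF theta_of_nat] G_def H_def n(2)[symmetric] ..
  also have "\<dots> = 2 * (of_nat p * K) + of_nat p * (\<Sum>x<p. H (of_nat x))"
    unfolding dG[symmetric] by (simp add: sum.distrib sum_distrib_left)
  finally have eq: "144 * theta (theta f) = of_nat p * (2 * K + (\<Sum>x<p. H (of_nat x)))"
    by (simp add: algebra_simps)
  show ?thesis unfolding fps_null_def
  proof (intro allI impI)
    fix k assume k: "k < p"
    show "p_divides p ((f - fps_const (f $ 0)) $ k)"
    proof (cases "k = 0")
      case False
      let ?c = "(2 ^ 4 * 3 ^ 2 * (int k * int k))"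
      have "\<not> int p dvd int k" using k False by (auto dest!: zdvd_imp_le)
      then have c: "\<not> int p dvd ?c"
        by (intro not_dvd_product not_dvd_power not_dvd_small)
      have "fps_integral p (2 * K + (\<Sum>x<p. H (of_nat x)))" by (intro integral_intros K H)
      from fps_null_of_nat_mult[OF p(1) this] have "p_divides p ((144 * theta (theta f)) $ k)"
        using k by (simp add: fps_null_def eq)
      also have "(144 * theta (theta f)) $ k = of_int ?c * f $ k"
        by (simp add: numeral_fps_const theta_nth)
      finally have "p_divides p (f $ k)" using p_divides_cancel[OF p(1) c] by blast
      then show ?thesis using False by simp
    qed (simp add: p_divides_0[OF p(1)])
  qed
qed

text \<open>The cusp \<open>j = \<infinity>\<close> corresponds to \<open>w = 1\<close>, where the cubic degenerates to \<open>(x - 6) (x + 3)\<^sup>2\<close>.\<close>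

lemma curve_sum_1: "[curve_sum p (1 :: int) ^ 2 = 1] (mod int p)"
proof -
  define m where "m = (p - 1) div 2"
  have pm: "p = 2 * m + 1" "m > 0" using odd_p p(2) by (auto simp: m_def)
  \<comment> \<open>The summand is the derivative of \<open>(x - 6)^(m + 1)\<close>, whose degree is
    small enough for the sum to vanish modulo \<open>p\<close>.\<close>
  have "int p dvd (\<Sum>x<p. int (Suc m) * (int x - 6) ^ m)"
  proof -
    have "(\<Sum>x<p. int (Suc m) * (int x - 6) ^ m) = (\<Sum>x<p. poly (pderiv ([:-6, 1:] ^ Suc m)) (of_nat x))"
      unfolding pderiv_power by (simp add: pderiv_pCons)
    moreover have "degree ([:-6, 1 :: int:] ^ Suc m) < 2 * p - 1"
      using pm by (simp add: degree_power_eq del: power_Suc)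
    ultimately show ?thesis using sum_poly_pderiv[OF p(1), of "[:-6, 1 :: int:] ^ Suc m"] by simp
  qed
  then have "int p dvd int (Suc m) * (\<Sum>x<p. (int x - 6) ^ m)" by (simp add: sum_distrib_left)
  moreover have "\<not> int p dvd int (Suc m)" using pm by (auto dest!: zdvd_imp_le)
  ultimately have 1: "[(\<Sum>x<p. (int x - 6) ^ m) = 0] (mod int p)"
    using not_dvd_product unfolding cong_0_iff by blast
  \<comment> \<open>Since \<open>2 * m = p - 1\<close>, the factor \<open>(x + 3)^(2 * m)\<close> is
    \<open>1\<close> modulo \<open>p\<close> except at \<open>x = p - 3\<close>, where it vanishes.
    The removed term is \<open>(- 9)^m\<close> modulo \<open>p\<close>, with square
    \<open>9^(p - 1)\<close>.\<close>
  let ?e = "\<lambda>x. if x = p - 3 then (int x - 6) ^ m else 0"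
  have "[curve_sum p (1 :: int) = (\<Sum>x<p. (int x - 6) ^ m - ?e x)] (mod int p)"
    unfolding curve_sum_def m_def[symmetric]
  proof (rule cong_sum)
    fix x assume x: "x \<in> {..<p}"
    have "1 * int x ^ 3 - 27 * (int x + 2) = (int x - 6) * (int x + 3) ^ 2" by algebra
    then have eq: "(1 * int x ^ 3 - 27 * (int x + 2)) ^ m = (int x - 6) ^ m * (int x + 3) ^ (p - 1)"
      using pm by (simp add: power_mult_distrib flip: power_mult)
    show "[(1 * of_nat x ^ 3 - 27 * (of_nat x + 2)) ^ m = (int x - 6) ^ m - ?e x] (mod int p)"
    proof (cases "x = p - 3")
      case True
      then have "int x + 3 = int p" using p(2) by simp
      then have "int p dvd (int x - 6) ^ m * (int x + 3) ^ (p - 1)" using p(2) by simp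
      then show ?thesis using True eq by (simp add: cong_0_iff)
    next
      case False
      have "\<not> int p dvd int x + 3"
      proof
        assume "int p dvd int x + 3"
        then obtain k where k: "int x + 3 = int p * k" ..
        have "0 < int p * k" "int p * k < int p * 2" using k[symmetric] x[unfolded lessThan_iff] p(2) by linarith+
        then have "0 < k" "k < 2" using p(2) by (auto simp: zero_less_mult_iff mult_less_cancel_left_pos)
        then have "k = 1" by simp
        then show False using k False by simp
      qed
      from cong_mult[OF cong_refl int_fermat[OF p(1) this], of "(int x - 6) ^ m"] show ?thesis
        using False by (simp add: eq[simplified])
    qed
  qed
  also have "(\<Sum>x<p. (int x - 6) ^ m - ?e x) = (\<Sum>x<p. (int x - 6) ^ m) - (int p - 9) ^ m"
    using p(2) by (simp add: sum_subtractf sum.delta of_nat_diff)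
  also have "[\<dots> = 0 - (- 9) ^ m] (mod int p)"
    by (intro cong_diff 1 cong_pow) (simp add: cong_iff_dvd_diff)
  finally have "[curve_sum p (1 :: int) ^ 2 = (0 - (- 9) ^ m) ^ 2] (mod int p)"
    by (rule cong_pow)
  also have "(0 - (- 9 :: int) ^ m) ^ 2 = 9 ^ (p - 1)"
    using pm by (simp add: power2_eq_square power_mult flip: power_mult_distrib)
  also have "[\<dots> = 1] (mod int p)"
    using int_fermat[OF p(1), of "3 ^ 2"] not_dvd_power[OF not_dvd_small(2), of 2] by simp
  finally show ?thesis .
qed

text \<open>For \<open>f = mu^m * S\<close> with \<open>p = 2 * m + 1\<close> one has
  \<open>f^2 * mu = mu^p * S^2\<close>. Here \<open>f^2\<close> and \<open>mu^p\<close> are both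
  \<open>1\<close> modulo \<open>p\<close> and \<open>q^p\<close>.\<close>

lemma fps_null_curve_sum: "fps_null p (curve_sum p ratio ^ 2 - mu)"
proof -
  define m where "m = (p - 1) div 2"
  have pm: "p = Suc (2 * m)" using odd_p by (simp add: m_def)
  let ?S = "curve_sum p ratio"
  define f where "f = (\<Sum>x<p. poly cubic (of_nat x) ^ m)"
  have f: "f = mu ^ m * ?S" using curve_sum_ratio[of p] by (simp add: f_def m_def)
  have S: "fps_integral p ?S" unfolding curve_sum_def by (intro integral_intros fps_integral_ratio)
  have fi: "fps_integral p f" unfolding f by (intro integral_intros S fps_integral_mu)
  let ?c = "fps_const (f $ 0)"
  \<comment> \<open>Both \<open>kappa\<close> and \<open>mu\<close> have constant term 1, so the
    constant term of \<open>f\<close> is the curve sum at the cusp.\<close>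
  have "f $ 0 = of_int (curve_sum p 1)"
    unfolding f_def poly_cubic curve_sum_def m_def
    by (simp add: fps_sum_nth fps_power_zeroth numeral_fps_const flip: fps_of_nat)
  then have "p_divides p ((f $ 0) ^ 2 - 1)"
    using curve_sum_1 p_divides_of_int[OF p(1), of "curve_sum p 1 ^ 2 - 1"] by (simp add: cong_iff_dvd_diff)
  then have c: "fps_null p (?c ^ 2 - 1)"
    by (simp add: fps_null_def fps_const_power p_divides_0[OF p(1)])
  have "fps_null p ((f - ?c) * (f + ?c))"
    using fps_null_cubic_sum fi
    by (intro fps_null_mult[OF p(1)] integral_intros fps_integral_const[OF p(1)])
      (auto simp: f_def m_def fps_integral_def)
  from fps_null_add[OF p(1) this c] have "fps_null p (f ^ 2 - 1)"
    by (simp add: algebra_simps power2_eq_square)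
  then have 1: "fps_null p ((f ^ 2 - 1) * mu)" by (intro fps_null_mult[OF p(1)] fps_integral_mu)
  have 2: "fps_null p ((mu ^ p - 1) * ?S ^ 2)"
    by (intro fps_null_mult[OF p(1)] fps_null_power_p[OF p(1)] fps_integral_mu integral_intros S) simp
  have "f ^ 2 * mu = mu ^ p * ?S ^ 2"
    unfolding f by (simp add: pm power_mult_distrib power_mult power_even_eq algebra_simps)
  then have "(f ^ 2 - 1) * mu - (mu ^ p - 1) * ?S ^ 2 = ?S ^ 2 - mu"
    by (simp add: algebra_simps)
  with fps_null_diff[OF p(1) 1 2] show ?thesis by simp
qed

section \<open>The coefficient of \<open>E4 / (j - c)\<close>\<close>

text \<open>Since \<open>kappa j_inv ^ n\<close> is \<open>theta (j_inv ^ n) / n\<close>, its \<open>p\<close>-th coefficient is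
  divisible by \<open>p\<close> unless \<open>n = p\<close>.\<close>

lemma kappa_j_inv_power_nth:
  assumes n: "n > 0"
  shows "p_divides p ((kappa * j_inv ^ n) $ p - (if n = p then 1 else 0))"
proof -
  have "theta (j_inv ^ n) = of_nat n * (j_inv ^ (n - 1) * j_inv) * kappa"
    by (simp add: theta_power theta_j_inv)
  also have "j_inv ^ (n - 1) * j_inv = j_inv ^ n"
    using n by (metis power_minus_mult)
  finally have "theta (j_inv ^ n) $ p = (of_nat n * (kappa * j_inv ^ n)) $ p"
    by (simp add: mult_ac)
  then have eq: "of_nat p * (j_inv ^ n) $ p = of_nat n * (kappa * j_inv ^ n) $ p"
    by (simp add: theta_nth flip: fps_of_nat)
  consider "n < p" | "n = p" | "n > p" by linarith
  then show ?thesis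
  proof cases
    case 1
    have "\<not> int p dvd int n" using 1 n by (auto dest!: zdvd_imp_le)
    moreover have "fps_integral p (j_inv ^ n)"
      by (intro fps_integral_power fps_integral_j_inv p(1))
    then have "p_divides p (of_int (int n) * (kappa * j_inv ^ n) $ p)"
      using p_divides_of_nat_mult[OF p(1), of "(j_inv ^ n) $ p"] by (simp add: eq fps_integral_def)
    ultimately have "p_divides p ((kappa * j_inv ^ n) $ p)"
      by (rule p_divides_cancel[OF p(1)])
    then show ?thesis using 1 by simp
  next
    case 2
    have "(j_inv ^ p) $ p = 1"
      using startsby_zero_power_nth_same[OF j_inv_nth_0, of p] j_inv_nth_1 by simp
    with eq 2 n show ?thesis by (simp add: p_divides_0[OF p(1)])
  next
    case 3
    then have "(j_inv ^ n) $ p = 0"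
      using startsby_zero_power_prefix[OF j_inv_nth_0, of n] by simp
    with eq 3 n show ?thesis by (simp add: p_divides_0[OF p(1)])
  qed
qed

text \<open>Replacing \<open>mu\<close> by \<open>R\<close> evaluated at \<open>j_inv\<close> in
  \<open>E4 = kappa * mu\<close> writes the series as a combination of
  \<open>kappa * j_inv ^ (Suc n + k)\<close>. Modulo \<open>p\<close> only the term with
  \<open>Suc n + k = p\<close> has a nonzero \<open>p\<close>-th coefficient.\<close>

lemma E4_j_inv_power_nth:
  fixes R :: "rat poly"
  defines "R \<equiv> curve_sum p [:1, - 1728:] ^ 2"
  assumes n: "n < p"
  shows "p_divides p ((E4 * j_inv ^ Suc n) $ p - coeff R (p - Suc n))"
proof -
  have "degree R \<le> 2 * ((p - 1) div 2)"
    unfolding R_def using degree_curve_sum[of "[:1, - 1728 :: rat:]" p]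
      degree_power_le[of "curve_sum p [:1, - 1728 :: rat:]" 2]
    by (simp add: mult.commute)
  also have "\<dots> < p" using odd_p by linarith
  finally have deg: "degree R < p" .
  have "fps_of_poly R oo j_inv = curve_sum p (fps_of_poly [:1, - 1728:] oo j_inv) ^ 2"
    unfolding R_def fps_of_poly_power fps_of_poly_curve_sum
    by (simp add: fps_compose_power[OF j_inv_nth_0, symmetric] fps_compose_curve_sum)
  also have "fps_of_poly [:1, - 1728:] oo j_inv = ratio"
  proof -
    have "fps_of_poly [:1, - 1728 :: rat:] = 1 - 1728 * fps_X"
      by (simp add: fps_of_poly_pCons fps_of_poly_simps numeral_fps_const)
    also have "\<dots> oo j_inv = 1 - 1728 * j_inv"
      by (simp add: fps_compose_sub_distrib fps_compose_mult_distrib numeral_fps_const)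
    finally show ?thesis by (simp add: ratio_eq)
  qed
  finally have S: "curve_sum p ratio ^ 2 = (\<Sum>k<p. fps_const (coeff R k) * j_inv ^ k)"
    unfolding fps_of_poly_compose[OF deg j_inv_nth_0] ..
  have R: "p_integral p (coeff R k)" for k
  proof -
    have "fps_integral p (fps_of_poly R)"
      unfolding R_def fps_of_poly_power fps_of_poly_curve_sum
      unfolding curve_sum_def fps_of_poly_pCons
      by (intro fps_integral_intros[OF p(1)] fps_integral_const[OF p(1)] p_integral_rules[OF p(1)] p_integral_1[OF p(1)])
        (simp add: fps_integral_0[OF p(1)])
    then show ?thesis by (simp add: fps_integral_def)
  qed
  have T: "j_inv ^ Suc n $ 0 = 0" by simp
  \<comment> \<open>One factor \<open>j_inv\<close> is held back: as it has no constant term, the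
    \<open>p\<close>-th coefficient of \<open>j_inv * H\<close> involves only coefficients of
    \<open>H\<close> below \<open>p\<close>, where the congruence is known.\<close>
  define H where "H = kappa * (curve_sum p ratio ^ 2 - mu) * j_inv ^ n"
  have "fps_null p H"
    unfolding H_def
    using fps_null_mult[OF p(1) fps_null_curve_sum, of "kappa * j_inv ^ n"]
    by (simp add: fps_integral_mult[OF p(1)] fps_integral_power[OF p(1)] fps_integral_kappa
        fps_integral_j_inv mult_ac)
  then have "p_divides p ((j_inv * H) $ p)"
    unfolding fps_mult_nth using fps_integral_j_inv
  proof (intro p_divides_sum[OF p(1)])
    fix i assume "i \<in> {0..p}" and H: "fps_null p H" and T: "fps_integral p j_inv"
    show "p_divides p (j_inv $ i * H $ (p - i))"
    proof (cases "i = 0")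
      case False
      then have "p - i < p" using p(2) by simp
      then show ?thesis
        using H T p_divides_mult[OF p(1), of "H $ (p - i)" "j_inv $ i"]
        by (simp add: fps_null_def fps_integral_def mult.commute)
    qed (simp add: p_divides_0[OF p(1)])
  qed
  also have "j_inv * H = kappa * curve_sum p ratio ^ 2 * j_inv ^ Suc n - E4 * j_inv ^ Suc n"
    by (simp add: H_def algebra_simps flip: kappa_mult_mu)
  also have "kappa * curve_sum p ratio ^ 2 * j_inv ^ Suc n =
      (\<Sum>k<p. fps_const (coeff R k) * (kappa * j_inv ^ (Suc n + k)))"
    unfolding S by (simp add: sum_distrib_left sum_distrib_right power_add mult_ac)
  finally have 1: "p_divides p ((\<Sum>k<p. coeff R k * (kappa * j_inv ^ (Suc n + k)) $ p) - (E4 * j_inv ^ Suc n) $ p)"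
    by (simp only: fps_sub_nth fps_sum_nth fps_mult_left_const_nth)
  have 2: "p_divides p (\<Sum>k<p. coeff R k * ((kappa * j_inv ^ (Suc n + k)) $ p - (if Suc n + k = p then 1 else 0)))"
    by (intro p_divides_sum[OF p(1)], subst mult.commute,
        rule p_divides_mult[OF p(1) kappa_j_inv_power_nth R], simp)
  have "(\<Sum>k<p. coeff R k * (if Suc n + k = p then 1 else 0)) = (\<Sum>k<p. if k = p - Suc n then coeff R k else 0)"
    using n by (intro sum.cong) auto
  also have "\<dots> = coeff R (p - Suc n)" using n by simp
  finally have "(\<Sum>k<p. coeff R k * ((kappa * j_inv ^ (Suc n + k)) $ p - (if Suc n + k = p then 1 else 0))) =
      (\<Sum>k<p. coeff R k * (kappa * j_inv ^ (Suc n + k)) $ p) - coeff R (p - Suc n)"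
    by (simp add: right_diff_distrib sum_subtractf)
  with p_divides_diff[OF p(1) 2 1] show ?thesis by simp
qed

lemma E4_div_j_minus_cong:
  assumes c: "c \<noteq> 0" "p_integral p c" "p_integral p (1 / c)"
  shows "p_divides p (fls_nth (E4_div_j_minus c) (int p) - c ^ (p - 1) * curve_sum p (1 - 1728 / c) ^ 2)"
proof -
  define R :: "rat poly" where "R = curve_sum p [:1, - 1728:] ^ 2"
  have "degree R \<le> 2 * ((p - 1) div 2)"
    unfolding R_def using degree_curve_sum[of "[:1, - 1728 :: rat:]" p]
      degree_power_le[of "curve_sum p [:1, - 1728 :: rat:]" 2]
    by (simp add: mult.commute)
  also have "\<dots> = p - 1" using odd_p by linarith
  finally have deg: "degree R \<le> p - 1" .
  have "c ^ (p - 1) * curve_sum p (1 - 1728 / c) ^ 2 = c ^ (p - 1) * poly R (1 / c)"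
    by (simp add: R_def poly_curve_sum)
  also have "poly R (1 / c) = (\<Sum>k\<le>p - 1. coeff R k * (1 / c) ^ k)"
    using arg_cong[OF poly_as_sum_of_monoms'[OF deg], of "\<lambda>q. poly q (1 / c)"]
    by (simp add: poly_sum poly_monom)
  also have "{..p - 1} = {..<p}" using p(2) by auto
  \<comment> \<open>Multiplication by \<open>c^(p - 1)\<close> reverses the polynomial, in
    accordance with the index \<open>p - Suc n\<close> above.\<close>
  also have "c ^ (p - 1) * (\<Sum>k<p. coeff R k * (1 / c) ^ k) = (\<Sum>k<p. coeff R k * c ^ (p - Suc k))"
    unfolding sum_distrib_left
  proof (rule sum.cong)
    fix k assume "k \<in> {..<p}"
    then have "p - 1 = (p - Suc k) + k" by simp
    then have "c ^ (p - 1) = c ^ (p - Suc k) * c ^ k" by (metis power_add)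
    then show "c ^ (p - 1) * (coeff R k * (1 / c) ^ k) = coeff R k * c ^ (p - Suc k)"
      using c(1) by (simp add: power_divide)
  qed simp
  also have "\<dots> = (\<Sum>n<p. c ^ n * coeff R (p - Suc n))"
    by (rule sum.reindex_bij_witness[where i = "\<lambda>n. p - Suc n" and j = "\<lambda>n. p - Suc n"]) auto
  finally have "fls_nth (E4_div_j_minus c) (int p) - c ^ (p - 1) * curve_sum p (1 - 1728 / c) ^ 2 =
      (\<Sum>n<p. ((E4 * j_inv ^ Suc n) $ p - coeff R (p - Suc n)) * c ^ n)"
    unfolding E4_div_j_minus_nth by (simp add: sum_subtractf algebra_simps)
  also have "p_divides p \<dots>"
    using E4_j_inv_power_nth c(2) unfolding R_def
    by (intro p_divides_sum[OF p(1)] p_divides_mult[OF p(1)] p_integral_power[OF p(1)]) auto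
  finally show ?thesis .
qed

section \<open>Counting points\<close>

text \<open>By Fermat an exponent of at least \<open>p - 1\<close> can be lowered by
  \<open>p - 1\<close>, except at \<open>x = 0\<close> when the new exponent is 0.\<close>

lemma sum_powers_cong:
  assumes j: "j \<le> 2 * (p - 1)"
  shows "[(\<Sum>x<p. int x ^ j) = (if j = p - 1 \<or> j = 2 * (p - 1) then - 1 else 0)] (mod int p)"
proof -
  have step: "[int x ^ (p - 1 + i) = (if x = 0 then 0 else int x ^ i)] (mod int p)" if "x < p" for x i
  proof (cases "x = 0")
    case False
    then have "\<not> int p dvd int x" using that by (auto dest!: zdvd_imp_le)
    from cong_mult[OF int_fermat[OF p(1) this] cong_refl[of "int x ^ i"]] show ?thesis
      using False by (simp add: power_add)
  qed (use p(2) in \<open>simp add: zero_power\<close>)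
  have 0: "(\<Sum>x<p. if x = 0 then 0 else f x) = (\<Sum>x<p. f x) - f 0" for f :: "nat \<Rightarrow> int"
    using p(2) sum.remove[of "{..<p}" 0 f] sum.remove[of "{..<p}" 0 "\<lambda>x. if x = 0 then 0 else f x"]
    by (simp add: sum.If_cases)
  \<comment> \<open>The correction \<open>0 ^ i\<close> is 1 for \<open>i = 0\<close> only, and it
    is the source of the value \<open>- 1\<close>.\<close>
  have 1: "[(\<Sum>x<p. int x ^ (p - 1 + i)) = (\<Sum>x<p. int x ^ i) - 0 ^ i] (mod int p)" for i
  proof -
    have "[(\<Sum>x<p. int x ^ (p - 1 + i)) = (\<Sum>x<p. if x = 0 then 0 else int x ^ i)] (mod int p)"
      by (intro cong_sum step) auto
    then show ?thesis by (simp add: 0)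
  qed
  have base: "[(\<Sum>x<p. int x ^ i) = 0] (mod int p)" if "i < p - 1" for i
    using prime_dvd_sum_powers[OF p(1) that] by (simp add: cong_0_iff)
  have mid: "[(\<Sum>x<p. int x ^ (p - 1)) = - 1] (mod int p)"
    using cong_trans[OF 1[of 0], of "- 1"] by (simp add: cong_iff_dvd_diff)
  consider "j < p - 1" | "j = p - 1" | "p - 1 < j" "j < 2 * (p - 1)" | "j = 2 * (p - 1)"
    using j by linarith
  then show ?thesis
  proof cases
    case 3
    then obtain i where i: "j = p - 1 + i" "0 < i" by (metis less_imp_add_positive)
    with 3 have "i < p - 1" by simp
    with cong_trans[OF 1[of i] cong_diff[OF base cong_refl]] i 3 show ?thesis by (simp add: zero_power)
  next
    case 4
    then have "j = p - 1 + (p - 1)" by simp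
    with cong_trans[OF 1[of "p - 1"] cong_diff[OF mid cong_refl]] 4 p(2) show ?thesis by (simp add: zero_power)
  qed (use base mid p(2) in auto)
qed

text \<open>As \<open>a\<close> is a unit modulo \<open>p\<close>, the affine map permutes the
  residues, and \<open>h\<close> depends on residues only.\<close>

lemma sum_affine_cong:
  fixes h :: "int \<Rightarrow> int"
  assumes a: "\<not> int p dvd a" and h: "\<And>u v. [u = v] (mod int p) \<Longrightarrow> [h u = h v] (mod int p)"
  shows "[(\<Sum>x<p. h (a * int x + b)) = (\<Sum>x<p. h (int x))] (mod int p)"
proof -
  let ?f = "\<lambda>x :: nat. nat ((a * int x + b) mod int p)"
  have p0: "int p > 0" using p(2) by simp
  have f: "int (?f x) = (a * int x + b) mod int p" for x using p0 by simp
  have "inj_on ?f {..<p}"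
  proof (rule inj_onI)
    fix x y assume xy: "x \<in> {..<p}" "y \<in> {..<p}" "?f x = ?f y"
    then have "(a * int x + b) mod int p = (a * int y + b) mod int p" using f by metis
    then have "int p dvd (a * int x + b) - (a * int y + b)" by (simp add: mod_eq_dvd_iff)
    then have "int p dvd a * (int x - int y)" by (simp add: algebra_simps)
    then have "int p dvd int x - int y" using a not_dvd_product by blast
    then have "int x mod int p = int y mod int p" by (simp add: mod_eq_dvd_iff)
    then show "x = y" using xy by simp
  qed
  moreover have "?f ` {..<p} \<subseteq> {..<p}" using p0 by (auto simp: nat_less_iff)
  ultimately have "?f ` {..<p} = {..<p}" by (meson card_image card_subset_eq finite_lessThan)
  with \<open>inj_on ?f {..<p}\<close> have "(\<Sum>x<p. h (int x)) = (\<Sum>x<p. h (int (?f x)))"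
    by (metis (no_types, lifting) sum.cong sum.reindex_cong)
  also have "[\<dots> = (\<Sum>x<p. h (a * int x + b))] (mod int p)"
    by (intro cong_sum h) (simp add: f cong_def)
  finally show ?thesis by (rule cong_sym)
qed

text \<open>Multiplied by \<open>u - v\<close>, the sum becomes \<open>u\<^sup>p - v\<^sup>p\<close>, which is \<open>u - v\<close> modulo \<open>p\<close>. In contrast to
  \<open>1 - (u - v)\<^sup>p\<^sup>-\<^sup>1\<close>, this indicator expands without binomial coefficients.\<close>

lemma indicator_cong:
  fixes u v :: int
  shows "[(if [u = v] (mod int p) then 1 else 0) = 1 - (\<Sum>k<p. u ^ k * v ^ (p - Suc k))] (mod int p)"
proof -
  let ?S = "\<Sum>k<p. u ^ k * v ^ (p - Suc k)"
  have pow: "[u ^ p = u] (mod int p)" for u :: int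
  proof (cases "int p dvd u")
    case True
    then have "int p dvd u ^ p" using p(2) by (cases p) (auto intro: dvd_mult2)
    then show ?thesis using True by (simp add: cong_iff_dvd_diff)
  next
    case False
    have "u ^ p = u * u ^ (p - 1)" using p(2) by (simp add: power_eq_if)
    with cong_mult[OF cong_refl int_fermat[OF p(1) False], of u] show ?thesis by simp
  qed
  show ?thesis
  proof (cases "[u = v] (mod int p)")
    case True
    have "[?S = (\<Sum>k<p. v ^ k * v ^ (p - Suc k))] (mod int p)"
      by (intro cong_sum cong_mult cong_pow True cong_refl)
    also have "(\<Sum>k<p. v ^ k * v ^ (p - Suc k)) = (\<Sum>k<p. v ^ (p - 1))"
      by (intro sum.cong) (auto simp flip: power_add)
    also have "[\<dots> = 0] (mod int p)" by (simp add: cong_0_iff)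
    finally show ?thesis using cong_diff[OF cong_refl[of 1 "int p"], of ?S 0] True cong_sym by fastforce
  next
    case False
    have "(u - v) * ?S = u ^ p - v ^ p"
      by (simp add: power_diff_sumr2 mult.commute)
    also have "[\<dots> = u - v] (mod int p)" by (intro cong_diff pow)
    finally have "int p dvd (u - v) * ?S - (u - v)" by (simp add: cong_iff_dvd_diff)
    then have "int p dvd (u - v) * (?S - 1)" by (simp add: algebra_simps)
    then have "int p dvd ?S - 1"
      using False not_dvd_product by (auto simp: cong_iff_dvd_diff)
    then have "int p dvd 0 - (1 - ?S)" by simp
    then show ?thesis using False by (simp only: cong_iff_dvd_diff if_False)
  qed
qed

text \<open>Euler's criterion in counting form. The indicator is summed over \<open>z\<close>, and
  the power sums of \<open>z\<close> leave only two exponents.\<close>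

lemma card_square_roots:
  "[int (card {z. z < p \<and> [int z ^ 2 = D] (mod int p)}) = 1 + D ^ ((p - 1) div 2)] (mod int p)"
proof -
  define m where "m = (p - 1) div 2"
  have pm: "p = 2 * m + 1" "m > 0" using odd_p p(2) by (auto simp: m_def)
  have "int (card {z. z < p \<and> [int z ^ 2 = D] (mod int p)}) =
      (\<Sum>z<p. if [int z ^ 2 = D] (mod int p) then 1 else 0)"
    by (simp add: sum.If_cases Int_def)
  also have "[\<dots> = (\<Sum>z<p. 1 - (\<Sum>k<p. (int z ^ 2) ^ k * D ^ (p - Suc k)))] (mod int p)"
    by (intro cong_sum indicator_cong)
  also have "(\<Sum>z<p. 1 - (\<Sum>k<p. (int z ^ 2) ^ k * D ^ (p - Suc k))) =
      int p - (\<Sum>k<p. (\<Sum>z<p. int z ^ (2 * k)) * D ^ (p - Suc k))"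
    unfolding sum_subtractf by (subst sum.swap) (simp add: sum_distrib_right flip: power_mult)
  also have "[\<dots> = 0 - (\<Sum>k<p. (if 2 * k = p - 1 \<or> 2 * k = 2 * (p - 1) then - 1 else 0) * D ^ (p - Suc k))] (mod int p)"
    by (intro cong_diff cong_sum cong_mult sum_powers_cong cong_refl) (auto simp: cong_0_iff)
  \<comment> \<open>The surviving indices are \<open>k = m\<close>, which contributes
    \<open>D^m\<close>, and \<open>k = p - 1\<close>, which contributes
    \<open>D^0 = 1\<close>.\<close>
  also have "(\<Sum>k<p. (if 2 * k = p - 1 \<or> 2 * k = 2 * (p - 1) then - 1 else 0) * D ^ (p - Suc k)) =
      (\<Sum>k\<in>{m, p - 1}. - (D ^ (p - Suc k)))"
    by (rule sum.mono_neutral_cong_right) (use pm in auto)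
  also have "\<dots> = - (D ^ m) - 1" using pm by simp
  finally show ?thesis by (simp add: m_def)
qed

text \<open>Completing the square with \<open>z = 2 * y + b\<close> reduces this to counting square
  roots of the discriminant.\<close>

lemma card_quadratic_roots:
  "[int (card {y. y < p \<and> [int y ^ 2 + b * int y = g] (mod int p)}) = 1 + (b ^ 2 + 4 * g) ^ ((p - 1) div 2)] (mod int p)"
proof -
  let ?D = "b ^ 2 + 4 * g"
  let ?h = "\<lambda>z :: int. if [z ^ 2 = ?D] (mod int p) then 1 else 0 :: int"
  have iff: "[int y ^ 2 + b * int y = g] (mod int p) \<longleftrightarrow> [(2 * int y + b) ^ 2 = ?D] (mod int p)" for y
  proof -
    have "(2 * int y + b) ^ 2 - ?D = 2 ^ 2 * (int y ^ 2 + b * int y - g)" by algebra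
    then show ?thesis
      using not_dvd_product[OF not_dvd_power[OF not_dvd_small(1), of 2]]
      by (metis cong_iff_dvd_diff dvd_mult)
  qed
  have "int (card {y. y < p \<and> [int y ^ 2 + b * int y = g] (mod int p)}) = (\<Sum>y<p. ?h (2 * int y + b))"
    by (simp add: iff sum.If_cases Int_def)
  also have "[\<dots> = (\<Sum>z<p. ?h (int z))] (mod int p)"
  proof (rule sum_affine_cong[OF not_dvd_small(1)])
    fix u v :: int assume "[u = v] (mod int p)"
    then have "[u ^ 2 = v ^ 2] (mod int p)" by (rule cong_pow)
    then have "[u ^ 2 = ?D] (mod int p) \<longleftrightarrow> [v ^ 2 = ?D] (mod int p)"
      by (meson cong_sym cong_trans)
    then show "[?h u = ?h v] (mod int p)" by simp
  qed
  also have "(\<Sum>z<p. ?h (int z)) = int (card {z. z < p \<and> [int z ^ 2 = ?D] (mod int p)})"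
    by (simp add: sum.If_cases Int_def)
  also have "[\<dots> = 1 + ?D ^ ((p - 1) div 2)] (mod int p)" by (rule card_square_roots)
  finally show ?thesis .
qed

text \<open>Completing the square in \<open>y\<close> gives the cubic \<open>h\<close>, and an
  affine substitution in \<open>x\<close> turns \<open>h\<close> into
  \<open>w x^3 - 27 (x + 2)\<close> times \<open>C6\<close> and the inverse of a square. The counts
  thus agree up to the twist \<open>C6^m\<close>, whose square is \<open>C6^(p - 1)\<close>, that is
  1 modulo \<open>p\<close>.\<close>

lemma point_count_cong:
  fixes A1 A2 A3 A4 A6 w :: int
  defines "B2 \<equiv> A1 ^ 2 + 4 * A2" and "B4 \<equiv> 2 * A4 + A1 * A3" and "B6 \<equiv> A3 ^ 2 + 4 * A6"
  defines "C4 \<equiv> B2 ^ 2 - 24 * B4" and "C6 \<equiv> - (B2 ^ 3) + 36 * B2 * B4 - 216 * B6"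
  defines "N \<equiv> int (card {(x, y). x < p \<and> y < p \<and> [int y ^ 2 + A1 * int x * int y + A3 * int y =
    int x ^ 3 + A2 * int x ^ 2 + A4 * int x + A6] (mod int p)})"
  assumes C4: "\<not> int p dvd C4" and C6: "\<not> int p dvd C6" and w: "[C4 ^ 3 * w = C6 ^ 2] (mod int p)"
  shows "[N ^ 2 = curve_sum p w ^ 2] (mod int p)"
proof -
  define m where "m = (p - 1) div 2"
  have pm: "p - 1 = 2 * m" using odd_p by (simp add: m_def)
  have p0: "[int p = 0] (mod int p)" by (simp add: cong_0_iff)
  define h where "h = (\<lambda>x :: int. 4 * x ^ 3 + B2 * x ^ 2 + 2 * B4 * x + B6)"
  have "N = (\<Sum>x<p. int (card {y. y < p \<and> [int y ^ 2 + (A1 * int x + A3) * int y =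
      int x ^ 3 + A2 * int x ^ 2 + A4 * int x + A6] (mod int p)}))"
  proof -
    have "{(x, y). x < p \<and> y < p \<and> [int y ^ 2 + A1 * int x * int y + A3 * int y =
        int x ^ 3 + A2 * int x ^ 2 + A4 * int x + A6] (mod int p)} =
      Sigma {..<p} (\<lambda>x. {y. y < p \<and> [int y ^ 2 + (A1 * int x + A3) * int y =
        int x ^ 3 + A2 * int x ^ 2 + A4 * int x + A6] (mod int p)})"
      by (auto simp: distrib_right add.assoc)
    then show ?thesis unfolding N_def by simp
  qed
  also have "[\<dots> = (\<Sum>x<p. 1 + h (int x) ^ m)] (mod int p)"
  proof (rule cong_sum)
    fix x
    have "(A1 * int x + A3) ^ 2 + 4 * (int x ^ 3 + A2 * int x ^ 2 + A4 * int x + A6) = h (int x)"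
      unfolding h_def B2_def B4_def B6_def by algebra
    with card_quadratic_roots[of "A1 * int x + A3" "int x ^ 3 + A2 * int x ^ 2 + A4 * int x + A6"]
    show "[int (card {y. y < p \<and> [int y ^ 2 + (A1 * int x + A3) * int y =
      int x ^ 3 + A2 * int x ^ 2 + A4 * int x + A6] (mod int p)}) = 1 + h (int x) ^ m] (mod int p)"
      unfolding m_def by simp
  qed
  also have "(\<Sum>x<p. 1 + h (int x) ^ m) = int p + (\<Sum>x<p. h (int x) ^ m)"
    by (simp add: sum.distrib)
  also have "[\<dots> = 0 + (\<Sum>x<p. h (int x) ^ m)] (mod int p)"
    by (intro cong_add p0 cong_refl)
  finally have N: "[N = (\<Sum>x<p. h (int x) ^ m)] (mod int p)" by simp
  have inverse: "\<exists>x. [k * x = l] (mod int p)" if "\<not> int p dvd k" for k l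
  proof -
    have "coprime k (int p)"
      using that p(1) by (meson coprime_commute prime_imp_coprime prime_nat_int_transfer)
    then obtain x where "[k * x = 1] (mod int p)" using cong_solve_coprime_int by blast
    from cong_mult[OF this cong_refl[of l]] show ?thesis by (auto simp: mult.assoc)
  qed
  have "\<not> int p dvd 2 ^ 2 * 3 ^ 2 * C4" "\<not> int p dvd 2 ^ 2 * 3"
    by (intro not_dvd_product not_dvd_power not_dvd_small C4)+
  then have "\<not> int p dvd 36 * C4" "\<not> int p dvd 12" by simp_all
  \<comment> \<open>For \<open>X = 36 x + 3 B2\<close> one has
    \<open>11664 h(x) = X^3 - 27 C4 X - 54 C6\<close>. The choice of \<open>a\<close> and
    \<open>b\<close> makes \<open>X\<close> equal to \<open>(C6 / C4) x\<close> in the new variable,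
    which brings the linear and the constant term into the ratio 1 : 2.\<close>
  then obtain a b where a: "[36 * C4 * a = C6] (mod int p)" and b: "[12 * b = - B2] (mod int p)"
    using inverse by metis
  have a0: "\<not> int p dvd a"
  proof
    assume "int p dvd a"
    then have "int p dvd 36 * C4 * a" by (rule dvd_mult)
    then show False using a C6 cong_dvd_iff by blast
  qed
  have h_cong: "[h u ^ m = h v ^ m] (mod int p)" if "[u = v] (mod int p)" for u v
    unfolding h_def by (intro cong_pow cong_add cong_mult cong_refl that)
  have key: "[11664 * h (a * x + b) = C6 * (w * x ^ 3 - 27 * (x + 2))] (mod int p)" for x
  proof -
    define X where "X = 36 * (a * x + b) + 3 * B2"
    have X: "[X = 36 * a * x] (mod int p)"
    proof -
      have "X - 36 * a * x = 3 * (12 * b - (- B2))" by (simp add: X_def)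
      moreover have "int p dvd 3 * (12 * b - (- B2))"
        using b by (intro dvd_mult) (simp only: cong_iff_dvd_diff)
      ultimately show ?thesis by (simp only: cong_iff_dvd_diff)
    qed
    have CX: "[C4 * X = C6 * x] (mod int p)"
    proof -
      have "[C4 * X = C4 * (36 * a * x)] (mod int p)" by (intro cong_mult X cong_refl)
      also have "C4 * (36 * a * x) = (36 * C4 * a) * x" by simp
      also have "[\<dots> = C6 * x] (mod int p)" by (intro cong_mult a cong_refl)
      finally show ?thesis .
    qed
    have "C4 ^ 3 * (11664 * h (a * x + b)) = (C4 * X) ^ 3 - 27 * C4 ^ 3 * (C4 * X) - 54 * C4 ^ 3 * C6"
      unfolding X_def h_def C4_def C6_def by algebra
    also have "[\<dots> = (C6 * x) ^ 3 - 27 * C4 ^ 3 * (C6 * x) - 54 * C4 ^ 3 * C6] (mod int p)"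
      by (intro cong_diff cong_mult cong_pow CX cong_refl)
    also have "(C6 * x) ^ 3 - 27 * C4 ^ 3 * (C6 * x) - 54 * C4 ^ 3 * C6 =
        C6 ^ 2 * (C6 * x ^ 3) - 27 * C4 ^ 3 * (C6 * x) - 54 * C4 ^ 3 * C6" by algebra
    also have "[\<dots> = (C4 ^ 3 * w) * (C6 * x ^ 3) - 27 * C4 ^ 3 * (C6 * x) - 54 * C4 ^ 3 * C6] (mod int p)"
      by (intro cong_diff cong_mult cong_sym[OF w] cong_refl)
    also have "(C4 ^ 3 * w) * (C6 * x ^ 3) - 27 * C4 ^ 3 * (C6 * x) - 54 * C4 ^ 3 * C6 =
        C4 ^ 3 * (C6 * (w * x ^ 3 - 27 * (x + 2)))" by algebra
    finally have "int p dvd C4 ^ 3 * (11664 * h (a * x + b) - C6 * (w * x ^ 3 - 27 * (x + 2)))"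
      by (simp add: cong_iff_dvd_diff right_diff_distrib)
    then show ?thesis
      using not_dvd_product[OF not_dvd_power[OF C4]] by (auto simp: cong_iff_dvd_diff)
  qed
  have "\<not> int p dvd 2 ^ 2 * 3 ^ 3"
    by (intro not_dvd_product not_dvd_power not_dvd_small)
  then have "[108 ^ (p - 1) = 1] (mod int p)" using int_fermat[OF p(1), of 108] by simp
  \<comment> \<open>Here \<open>11664 = 108^2\<close>, so that its \<open>m\<close>-th power is
    \<open>108^(p - 1)\<close>.\<close>
  then have one: "[11664 ^ m = 1] (mod int p)" unfolding pm power_mult by simp
  have "[1 * (\<Sum>x<p. h (int x) ^ m) = 11664 ^ m * (\<Sum>x<p. h (a * int x + b) ^ m)] (mod int p)"
    by (intro cong_mult cong_sym[OF one] cong_sym[OF sum_affine_cong[OF a0, of "\<lambda>x. h x ^ m"]] h_cong)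
  also have "11664 ^ m * (\<Sum>x<p. h (a * int x + b) ^ m) = (\<Sum>x<p. (11664 * h (a * int x + b)) ^ m)"
    by (simp add: sum_distrib_left power_mult_distrib)
  also have "[\<dots> = (\<Sum>x<p. (C6 * (w * int x ^ 3 - 27 * (int x + 2))) ^ m)] (mod int p)"
    by (intro cong_sum cong_pow key)
  also have "(\<Sum>x<p. (C6 * (w * int x ^ 3 - 27 * (int x + 2))) ^ m) = C6 ^ m * curve_sum p w"
    by (simp add: curve_sum_def m_def sum_distrib_left power_mult_distrib)
  finally have "[N = C6 ^ m * curve_sum p w] (mod int p)"
    using cong_trans[OF N] by simp
  then have "[N ^ 2 = (C6 ^ m * curve_sum p w) ^ 2] (mod int p)" by (rule cong_pow)
  also have "(C6 ^ m * curve_sum p w) ^ 2 = C6 ^ (p - 1) * curve_sum p w ^ 2"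
    unfolding pm by (simp add: power_mult_distrib mult.commute flip: power_mult)
  also have "[\<dots> = 1 * curve_sum p w ^ 2] (mod int p)"
    by (intro cong_mult int_fermat[OF p(1) C6] cong_refl)
  finally show ?thesis by simp
qed

section \<open>From the point count to the Frobenius trace\<close>

lemma rat_cong_curve_sum: "rat_cong p x y \<Longrightarrow> rat_cong p (curve_sum p x) (curve_sum p y)"
  unfolding curve_sum_def
  by (intro rat_cong_sum[OF p(1)] rat_cong_power[OF p(1)] rat_cong_diff[OF p(1)] rat_cong_mult[OF p(1)]
      rat_cong_refl[OF p(1)] p_integral_rules[OF p(1)] p_integral_of_nat[OF p(1)])

lemma unit_representative:
  assumes n: "rat_cong p (of_int n) x" and x: "p_integral p (1 / x)" "x \<noteq> 0"
  shows "\<not> int p dvd n"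
proof
  assume "int p dvd n"
  then have "p_divides p (of_int n)" by (rule p_divides_of_int[OF p(1)])
  moreover have "p_divides p (of_int n - x)" using n by (simp add: rat_cong_iff_divides[OF p(1)])
  ultimately have "p_divides p x" using p_divides_diff[OF p(1), of "of_int n" "of_int n - x"] by simp
  then have "p_divides p (x * (1 / x))" using x by (intro p_divides_mult[OF p(1)]) simp_all
  then have "p_integral p (1 / of_nat p)" using x by (simp add: p_divides_def)
  then obtain a b where ab: "\<not> int p dvd b" "1 / of_nat p = (of_int a / of_int b :: rat)"
    using p_integral_iff[OF p(1)] by blast
  then have "(of_int b :: rat) = of_int (int p * a)"
    using p(2) by (auto simp: field_simps)
  then show False using ab(1) unfolding of_int_eq_iff by simp
qed

text \<open>The coefficients of the model are replaced by integer representatives modulo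
  \<open>p\<close>, which preserves the solution set and the classes of \<open>c4\<close> and
  \<open>c6\<close>. The integer point count then applies.\<close>

lemma frob_trace_square_cong:
  assumes M: "good_model p W M"
    and C4: "p_integral p (1 / c4 M)" "c4 M \<noteq> 0"
    and C6: "p_integral p (1 / c6 M)" "c6 M \<noteq> 0"
    and w: "p_integral p w" "c4 M ^ 3 * w = c6 M ^ 2"
  shows "rat_cong p (curve_sum p w ^ 2) (of_int (frob_trace p W ^ 2))"
proof -
  note I = p_integral_rules[OF p(1)] p_integral_of_nat[OF p(1)]
  note R = rat_cong_add[OF p(1)] rat_cong_diff[OF p(1)] rat_cong_mult[OF p(1)] rat_cong_power[OF p(1)]
    rat_cong_refl[OF p(1)]
  have iM: "p_integral p (a1 M)" "p_integral p (a2 M)" "p_integral p (a3 M)" "p_integral p (a4 M)" "p_integral p (a6 M)"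
    using M unfolding good_model_def by auto
  define A1 A2 A3 A4 A6 v where A: "A1 = res_mod p (a1 M)" "A2 = res_mod p (a2 M)" "A3 = res_mod p (a3 M)"
    "A4 = res_mod p (a4 M)" "A6 = res_mod p (a6 M)" "v = res_mod p w"
  have A: "rat_cong p (of_int A1) (a1 M)" "rat_cong p (of_int A2) (a2 M)" "rat_cong p (of_int A3) (a3 M)"
    "rat_cong p (of_int A4) (a4 M)" "rat_cong p (of_int A6) (a6 M)" "rat_cong p (of_int v) w"
    using res_mod[OF p(1)] iM w(1) unfolding A by blast+
  define B2 B4 B6 where B: "B2 = A1 ^ 2 + 4 * A2" "B4 = 2 * A4 + A1 * A3" "B6 = A3 ^ 2 + 4 * A6"
  define K4 K6 where K: "K4 = B2 ^ 2 - 24 * B4" "K6 = - (B2 ^ 3) + 36 * B2 * B4 - 216 * B6"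
  have B': "rat_cong p (of_int B2) (b2 M)" "rat_cong p (of_int B4) (b4 M)" "rat_cong p (of_int B6) (b6 M)"
    unfolding B b2_def b4_def b6_def of_int_add of_int_mult of_int_power of_int_numeral
    by (intro R A I)+
  have K4: "rat_cong p (of_int K4) (c4 M)"
    unfolding K c4_def of_int_diff of_int_mult of_int_power of_int_numeral by (intro R B' I)
  have K6: "rat_cong p (of_int K6) (c6 M)"
  proof -
    have "rat_cong p (0 - of_int B2 ^ 3 + 36 * of_int B2 * of_int B4 - 216 * of_int B6)
        (0 - b2 M ^ 3 + 36 * b2 M * b4 M - 216 * b6 M)"
      by (intro R B' I p_integral_0[OF p(1)])
    then show ?thesis by (simp add: K c6_def)
  qed
  have "rat_cong p (of_int (K4 ^ 3 * v)) (c4 M ^ 3 * w)"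
    unfolding of_int_mult of_int_power by (intro R K4 A)
  moreover have "rat_cong p (c4 M ^ 3 * w) (of_int (K6 ^ 2))"
    unfolding w(2) of_int_power by (intro R rat_cong_sym[OF p(1) K6])
  ultimately have "rat_cong p (of_int (K4 ^ 3 * v)) (of_int (K6 ^ 2))"
    by (rule rat_cong_trans[OF p(1)])
  then have v: "[K4 ^ 3 * v = K6 ^ 2] (mod int p)"
    unfolding rat_cong_of_int_iff[OF p(1)] .
  define Q where "Q = {(x, y). x < p \<and> y < p \<and> [int y ^ 2 + A1 * int x * int y + A3 * int y =
    int x ^ 3 + A2 * int x ^ 2 + A4 * int x + A6] (mod int p)}"
  have N: "[int (card Q) ^ 2 = curve_sum p v ^ 2] (mod int p)"
    unfolding Q_def
    using unit_representative[OF K4 C4] unit_representative[OF K6 C6] v unfolding K B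
    by (rule point_count_cong)
  have iff: "rat_cong p ((of_int y)\<^sup>2 + a1 M * of_int x * of_int y + a3 M * of_int y)
        ((of_int x) ^ 3 + a2 M * (of_int x)\<^sup>2 + a4 M * of_int x + a6 M) \<longleftrightarrow>
      [y ^ 2 + A1 * x * y + A3 * y = x ^ 3 + A2 * x ^ 2 + A4 * x + A6] (mod int p)" for x y
  proof -
    have l: "rat_cong p (of_int (y ^ 2 + A1 * x * y + A3 * y)) ((of_int y)\<^sup>2 + a1 M * of_int x * of_int y + a3 M * of_int y)"
      and r: "rat_cong p (of_int (x ^ 3 + A2 * x ^ 2 + A4 * x + A6)) ((of_int x) ^ 3 + a2 M * (of_int x)\<^sup>2 + a4 M * of_int x + a6 M)"
      unfolding of_int_add of_int_mult of_int_power by (intro R A I)+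
    show ?thesis
      unfolding rat_cong_of_int_iff[OF p(1), symmetric]
      using l r rat_cong_trans[OF p(1)] rat_cong_sym[OF p(1)] by blast
  qed
  let ?f = "\<lambda>(x, y). Some (int x, int y)"
  have "Some ` {(x, y). x \<in> {0..<int p} \<and> y \<in> {0..<int p} \<and>
      [y ^ 2 + A1 * x * y + A3 * y = x ^ 3 + A2 * x ^ 2 + A4 * x + A6] (mod int p)} = ?f ` Q" (is "?L = _")
  proof
    show "?L \<subseteq> ?f ` Q"
    proof
      fix P assume "P \<in> ?L"
      then obtain x y where xy: "P = Some (x, y)" "x \<in> {0..<int p}" "y \<in> {0..<int p}"
        "[y ^ 2 + A1 * x * y + A3 * y = x ^ 3 + A2 * x ^ 2 + A4 * x + A6] (mod int p)" by blast
      then have "(nat x, nat y) \<in> Q" by (simp add: Q_def nat_less_iff)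
      moreover have "P = ?f (nat x, nat y)" using xy by simp
      ultimately show "P \<in> ?f ` Q" by (rule rev_image_eqI)
    qed
    show "?f ` Q \<subseteq> ?L"
    proof
      fix P assume "P \<in> ?f ` Q"
      then obtain x y where "(x, y) \<in> Q" "P = Some (int x, int y)" by auto
      then show "P \<in> ?L" unfolding Q_def by (intro image_eqI[of _ _ "(int x, int y)"]) simp_all
    qed
  qed
  then have "reduction_points p M = insert None (?f ` Q)"
    unfolding reduction_points_def iff by (rule arg_cong)
  moreover have "finite Q"
    by (rule finite_subset[of _ "{..<p} \<times> {..<p}"]) (auto simp: Q_def)
  moreover have "inj_on ?f Q" by (auto simp: inj_on_def)
  moreover have "None \<notin> ?f ` Q" by auto
  ultimately have "card (reduction_points p M) = Suc (card Q)"
    by (simp add: card_image)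
  \<comment> \<open>The point at infinity cancels the \<open>1\<close> in \<open>p + 1\<close>. The
    trace is therefore minus the affine count modulo \<open>p\<close>, a sign lost on
    squaring.\<close>
  then have "frob_trace p W = int p - int (card Q)"
    using frob_trace_eq[OF p M] by simp
  also have "[\<dots> = 0 - int (card Q)] (mod int p)"
    by (intro cong_diff cong_refl) (simp add: cong_0_iff)
  finally have "[frob_trace p W ^ 2 = (0 - int (card Q)) ^ 2] (mod int p)" by (rule cong_pow)
  then have "[curve_sum p v ^ 2 = frob_trace p W ^ 2] (mod int p)"
    using N by (simp add: cong_def)
  then have 1: "rat_cong p (of_int (curve_sum p v ^ 2)) (of_int (frob_trace p W ^ 2))"
    by (simp only: rat_cong_of_int_iff[OF p(1)])
  have "of_int (curve_sum p v) = curve_sum p (of_int v :: rat)"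
    by (simp add: curve_sum_def)
  then have "rat_cong p (curve_sum p w ^ 2) (of_int (curve_sum p v ^ 2))"
    unfolding of_int_power using rat_cong_sym[OF p(1) A(6)]
    by (auto intro: rat_cong_power[OF p(1)] rat_cong_curve_sum)
  then show ?thesis using 1 rat_cong_trans[OF p(1)] by blast
qed

end

theorem theorem1p3:
  fixes C :: weierstrass and p :: nat
  assumes "elliptic_curve C"
    and "j_invariant C \<notin> {0, 1728}"
    and "prime p" and "p \<ge> 5"
    and "good_reduction p C"
    and "padic_val p (j_invariant C) = 0"
    and "padic_val p (j_invariant C - 1728) = 0"
  shows "rat_cong p (fls_nth (E4_div_j_minus (j_invariant C)) (int p))
           (of_int ((frob_trace p C)\<^sup>2))"
proof -
  note p = \<open>prime p\<close> \<open>p \<ge> 5\<close>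
  note I = p_integral_rules[OF p(1)]
  define j where "j = j_invariant C"
  have j: "j \<noteq> 0" "j - 1728 \<noteq> 0" using assms(2) by (auto simp: j_def)
  have ji: "p_integral p j" "p_integral p (1 / j)" "p_integral p (1 / (j - 1728))"
    using padic_val_0_integral[OF p(1) j(1)] padic_val_0_integral[OF p(1) j(2)] assms(6,7) by (simp_all add: j_def)
  obtain M where M: "good_model p C M" using assms(5) unfolding good_reduction_def by blast
  define d where "d = discriminant M"
  have d: "d \<noteq> 0" "padic_val p d = 0" using M unfolding good_model_def d_def by auto
  have di: "p_integral p (1 / d)" using padic_val_0_integral(2)[OF p(1) d] .
  have "j = c4 M ^ 3 / d"
    using j_invariant_isomorphic[of C M] M unfolding good_model_def j_def d_def j_invariant_def by simp
  \<comment> \<open>The valuation hypotheses enter here: \<open>j\<close>, \<open>j - 1728\<close>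
    and the discriminant are units at \<open>p\<close>, hence so are the powers \<open>c4^3\<close>
    and \<open>c6^2\<close>, and with them \<open>c4\<close> and \<open>c6\<close>.\<close>
  then have c4: "c4 M ^ 3 = j * d" using d by simp
  have c6: "c6 M ^ 2 = (j - 1728) * d"
    using c4_c6_discriminant[of M] by (simp add: c4 d_def algebra_simps)
  have nz: "c4 M \<noteq> 0" "c6 M \<noteq> 0" using c4 c6 j d by auto
  have "p_integral p ((1 / c4 M) ^ 3)" "p_integral p ((1 / c6 M) ^ 2)"
    using I(3)[OF ji(2) di] I(3)[OF ji(3) di] by (simp_all add: power_divide c4 c6)
  then have c4i: "p_integral p (1 / c4 M)" and c6i: "p_integral p (1 / c6 M)"
    using p_integral_root[OF p(1), of "1 / c4 M" 3] p_integral_root[OF p(1), of "1 / c6 M" 2] by simp_all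
  define w where "w = 1 - 1728 / j"
  have "w = 1 - 1728 * (1 / j)" by (simp add: w_def)
  also have "p_integral p \<dots>" by (intro I ji(2) p_integral_1[OF p(1)])
  finally have wi: "p_integral p w" .
  have "c4 M ^ 3 * w = c6 M ^ 2"
    unfolding c4 c6 w_def using j(1) by (simp add: field_simps)
  then have 1: "rat_cong p (curve_sum p w ^ 2) (of_int (frob_trace p C ^ 2))"
    by (intro frob_trace_square_cong[OF p M] c4i c6i nz wi)
  \<comment> \<open>Fermat's theorem is stated for integers, so \<open>j\<close> is replaced by an
    integer representative to show that \<open>j^(p - 1)\<close> is 1 modulo
    \<open>p\<close>.\<close>
  define n where "n = res_mod p j"
  have n: "rat_cong p (of_int n) j" using res_mod[OF p(1) ji(1)] by (simp add: n_def)
  have "rat_cong p (j ^ (p - 1)) (of_int (n ^ (p - 1)))"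
    unfolding of_int_power by (intro rat_cong_power[OF p(1)] rat_cong_sym[OF p(1) n])
  moreover have "rat_cong p (of_int (n ^ (p - 1))) (of_int 1)"
    unfolding rat_cong_of_int_iff[OF p(1)]
    by (intro int_fermat[OF p(1)] unit_representative[OF p n ji(2) j(1)])
  ultimately have "rat_cong p (j ^ (p - 1)) (of_int 1)" by (rule rat_cong_trans[OF p(1)])
  then have "rat_cong p (j ^ (p - 1)) 1" by simp
  from rat_cong_mult[OF p(1) this 1]
  have 2: "rat_cong p (j ^ (p - 1) * curve_sum p w ^ 2) (of_int (frob_trace p C ^ 2))" by simp
  let ?a = "fls_nth (E4_div_j_minus j) (int p)"
  have 3: "p_divides p (?a - j ^ (p - 1) * curve_sum p w ^ 2)"
    unfolding w_def by (rule E4_div_j_minus_cong[OF p j(1) ji(1,2)])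
  have "p_integral p (?a - j ^ (p - 1) * curve_sum p w ^ 2 + j ^ (p - 1) * curve_sum p w ^ 2)"
    using rat_cong_integral[OF p(1) 2] p_divides_integral[OF p(1) 3] by (rule I(4)[rotated])
  then have "rat_cong p ?a (j ^ (p - 1) * curve_sum p w ^ 2)"
    using 3 rat_cong_integral[OF p(1) 2] by (simp add: rat_cong_iff_divides[OF p(1)])
  from rat_cong_trans[OF p(1) this 2] show ?thesis by (simp add: j_def)
qed

end
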